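(* Let $n\ge0$. Assume that $$M_{p,w}^{r,r-1}=-\frac1w\quad(r\ge1),\qquad M_{p,w}^{r,r}=0\quad(r\ge0)$$ on $\mathcal I_p$, that $\omega:\mathcal I_p\to(0,\infty)$ is locally absolutely continuous, and that the kernel hypotheses $\mathrm H(n,n;h^{(n)})$ and $\mathrm H(n+1,n;h^{(n)})$ (see context) hold. Put $\Lambda_{p,w,\omega}^n(x,v)=\omega'(x)K_{p,w}^{n,n}(x,v)+\omega(x)K_{p,w}^{n+1,n}(x,v)$. Then, for almost every $x\in\mathcal I_p$, $$\big(\omega f_{p,w,h}^{(n)}\big)'(x)=\frac{\omega(x)}{w(x)}h^{(n)}(x)+\mathbb E\big[\Lambda_{p,w,\omega}^n(x,Z)h^{(n)}(Z)\big],\qquad \mathbb E\big[\Lambda_{p,w,\omega}^n(x,Z)\big]=-\frac{\omega(x)}{w(x)}.$$ Consequently, $$\Big|\big(\omega f_{p,w,h}^{(n)}\big)'(x)\Big|\le\Big(\frac{\omega(x)}{w(x)}+V_{p,w,\omega}^n(x)\Big)\|h^{(n)}\|,\qquad V_{p,w,\omega}^n=\Big|\big(\omega\overline m_{p,w}^{(n)}\big)'\Big|\underline P_{n+1}+\Big|\big(\omega\underline m_{p,w}^{(n)}\big)'\Big|\overline P_{n+1}.$$ If moreover $$(-1)^n\big(\omega\overline m_{p,w}^{(n)}\big)'\le0,\qquad\big(\omega\underline m_{p,w}^{(n)}\big)'\ge0,$$ then $V_{p,w,\omega}^n=\omega/w$ and $$\Big|\big(\omega f_{p,w,h}^{(n)}\big)'(x)\Big|\le\frac{\omega(x)}{w(x)}\operatorname{osc}\big(h^{(n)}\big),\qquad\text{hence}\qquad\Big\|\big(\omega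 f_{p,w,h}^{(n)}\big)'\Big\|\le2\Big\|\frac\omega w\Big\|\,\|h^{(n)}\|.$$
   Context: Setting. $p$ is a probability density on $\mathbb R$ and $Z$ a random variable with density $p$. There are $m\ge1$ and $-\infty\le l=e_0<e_1<\dots<e_m=u\le\infty$ with $\{p>0\}=\mathcal I_p:=\bigcup_{r=1}^m(e_{r-1},e_r)$, and $p$ is locally absolutely continuous on each $(e_{r-1},e_r)$. The weight $w:\mathbb R\to\mathbb R$ is positive on $\mathcal I_p$ and $wp$ is locally absolutely continuous on each $(e_{r-1},e_r)$. Put $P(x)=\int_l^xp$, $\overline P(x)=\int_x^up$, $\mathcal Ph=\mathbb E[h(Z)]$. For $h\in L^1(p)$, $f_{p,w,h}(x)=\frac1{w(x)p(x)}\int_l^x(h(t)-\mathcal Ph)p(t)\,dt$, $x\in\mathcal I_p$. $\|\cdot\|$ denotes the essential supremum; $\operatorname{osc}(g)=\sup g-\inf g$; inequalities between a.e.-defined functions hold almost everywhere. Kernels. $\underline m_{p,w}=P/(wp)$ and $\overline m_{p,w}=\overline P/(wp)$ on $\mathcal I_p$; $\underline P_0=\overline P_0=p$ and, for $j\ge1$, $\underline P_j(x)=\int_l^x\underline P_{j-1}(t)\,dt$, $\overline P_j(x)=\int_x^u\overline P_{j-1}(t)\,dt$. For $i,j\ge0$ and $x,v\in\mathcal I_p$, $$K_{p,w}^{i,j}(x,v)=\frac1{p(v)}\Big[(-1)^j\overline m_{p,w}^{(i)}(x)\underline P_j(v)\mathbf 1_{\{v\le x\}}-\underline m_{p,w}^{(i)}(x)\overline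 P_j(v)\mathbf 1_{\{v>x\}}\Big],$$ and for $i\ge0$, $j\ge-1$, $M_{p,w}^{i,j}=(-1)^j\overline m_{p,w}^{(i)}\underline P_{j+1}-\underline m_{p,w}^{(i)}\overline P_{j+1}$. Superscripts in parentheses are ordinary derivatives. The identities assumed on $M_{p,w}^{r,r-1}$ and $M_{p,w}^{r,r}$ are required for those $r$ for which these functions are defined. Kernel hypotheses $\mathrm H(i,j;g)$, for integers $i,j\ge0$ and $g:\mathbb R\to\mathbb R$: for every $x\in\mathcal I_p$, (a) $\underline P_{j+1}(x),\overline P_{j+1}(x)$ are finite; (b) the derivatives of $\underline m_{p,w},\overline m_{p,w}$ through order $i+1$ are finite and locally absolutely continuous near $x$; (c) $g$ is locally absolutely continuous and $\mathbb E[|K_{p,w}^{i,j}(x,Z)g(Z)|+|K_{p,w}^{i,j+1}(x,Z)g'(Z)|+|K_{p,w}^{i+1,j}(x,Z)g(Z)|]<\infty$; (d) $g(v)P(v)\to0$ and $g(v)\underline P_{j+1}(v)\to0$ as $v\downarrow l$, and $g(v)\overline P(v)\to0$ and $g(v)\overline P_{j+1}(v)\to0$ as $v\uparrow u$. *)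

theory Defs
  imports "HOL-Probability.Probability"
begin

definition abs_cont_on :: "real set \<Rightarrow> (real \<Rightarrow> real) \<Rightarrow> bool" where
  "abs_cont_on S f \<longleftrightarrow>
     (\<forall>\<epsilon>>0. \<exists>\<delta>>0. \<forall>(k::nat) a b.
        (\<forall>i<k. a i \<le> b i \<and> {a i..b i} \<subseteq> S) \<and>
        (\<forall>i<k. \<forall>j<k. i \<noteq> j \<longrightarrow> {a i<..<b i} \<inter> {a j<..<b j} = {}) \<and>
        (\<Sum>i<k. b i - a i) < \<delta>
        \<longrightarrow> (\<Sum>i<k. \<bar>f (b i) - f (a i)\<bar>) < \<epsilon>)"

definition locally_abs_cont_on :: "real set \<Rightarrow> (real \<Rightarrow> real) \<Rightarrow> bool" where
  "locally_abs_cont_on S f \<longleftrightarrow> (\<forall>a b. a \<le> b \<and> {a..b} \<subseteq> S \<longrightarrow> abs_cont_on {a..b} f)"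

text \<open>The term \<open>(deriv ^^ k) f\<close> is total; on an open set \<open>S\<close> the following predicate
  says that the derivatives of order at most \<open>k\<close> exist as ordinary (finite) derivatives.\<close>

definition times_differentiable_on :: "nat \<Rightarrow> real set \<Rightarrow> (real \<Rightarrow> real) \<Rightarrow> bool" where
  "times_differentiable_on k S f \<longleftrightarrow> (\<forall>i<k. \<forall>x\<in>S. (deriv ^^ i) f field_differentiable at x)"

definition supp :: "(real \<Rightarrow> real) \<Rightarrow> real set" where
  "supp p = {x. 0 < p x}"

text \<open>The iterated integrals may be infinite, so they are defined in \<^typ>\<open>ennreal\<close>;
  \<open>lP\<close> and \<open>uP\<close> are the real values used wherever finiteness is known.
  The functions \<open>P\<close> and its complement are the case \<open>j = 1\<close>.\<close>

primrec lower_P :: "(real \<Rightarrow> real) \<Rightarrow> ereal \<Rightarrow> nat \<Rightarrow> real \<Rightarrow> ennreal" where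
  "lower_P p l 0 = (\<lambda>x. ennreal (p x))"
| "lower_P p l (Suc j) = (\<lambda>x. \<integral>\<^sup>+t\<in>einterval l (ereal x). lower_P p l j t \<partial>lborel)"

primrec upper_P :: "(real \<Rightarrow> real) \<Rightarrow> ereal \<Rightarrow> nat \<Rightarrow> real \<Rightarrow> ennreal" where
  "upper_P p u 0 = (\<lambda>x. ennreal (p x))"
| "upper_P p u (Suc j) = (\<lambda>x. \<integral>\<^sup>+t\<in>einterval (ereal x) u. upper_P p u j t \<partial>lborel)"

definition lP :: "(real \<Rightarrow> real) \<Rightarrow> ereal \<Rightarrow> nat \<Rightarrow> real \<Rightarrow> real" where
  "lP p l j x = enn2real (lower_P p l j x)"

definition uP :: "(real \<Rightarrow> real) \<Rightarrow> ereal \<Rightarrow> nat \<Rightarrow> real \<Rightarrow> real" where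
  "uP p u j x = enn2real (upper_P p u j x)"

definition lower_m :: "(real \<Rightarrow> real) \<Rightarrow> (real \<Rightarrow> real) \<Rightarrow> ereal \<Rightarrow> real \<Rightarrow> real" where
  "lower_m p w l x = lP p l 1 x / (w x * p x)"

definition upper_m :: "(real \<Rightarrow> real) \<Rightarrow> (real \<Rightarrow> real) \<Rightarrow> ereal \<Rightarrow> real \<Rightarrow> real" where
  "upper_m p w u x = uP p u 1 x / (w x * p x)"

definition stein_f ::
  "'a measure \<Rightarrow> ('a \<Rightarrow> real) \<Rightarrow> (real \<Rightarrow> real) \<Rightarrow> (real \<Rightarrow> real) \<Rightarrow> ereal \<Rightarrow> (real \<Rightarrow> real) \<Rightarrow> real \<Rightarrow> real"
where
  "stein_f M Z p w l h x =
     1 / (w x * p x) * (LBINT t=l..ereal x. (h t - (\<integral>s. h (Z s) \<partial>M)) * p t)"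

definition kernel_K ::
  "(real \<Rightarrow> real) \<Rightarrow> (real \<Rightarrow> real) \<Rightarrow> ereal \<Rightarrow> ereal \<Rightarrow> nat \<Rightarrow> nat \<Rightarrow> real \<Rightarrow> real \<Rightarrow> real"
where
  "kernel_K p w l u i j x v =
     1 / p v * ((-1) ^ j * (deriv ^^ i) (upper_m p w u) x * lP p l j v * indicator {v. v \<le> x} v
                - (deriv ^^ i) (lower_m p w l) x * uP p u j v * indicator {v. v > x} v)"

text \<open>The second index of \<open>M\<close> is an integer because it starts at \<open>-1\<close>.\<close>

definition fun_M ::
  "(real \<Rightarrow> real) \<Rightarrow> (real \<Rightarrow> real) \<Rightarrow> ereal \<Rightarrow> ereal \<Rightarrow> nat \<Rightarrow> int \<Rightarrow> real \<Rightarrow> real"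
where
  "fun_M p w l u i j x =
     (-1) powi j * (deriv ^^ i) (upper_m p w u) x * lP p l (nat (j + 1)) x
     - (deriv ^^ i) (lower_m p w l) x * uP p u (nat (j + 1)) x"

definition fun_M_defined ::
  "(real \<Rightarrow> real) \<Rightarrow> (real \<Rightarrow> real) \<Rightarrow> ereal \<Rightarrow> ereal \<Rightarrow> nat \<Rightarrow> int \<Rightarrow> bool"
where
  "fun_M_defined p w l u i j \<longleftrightarrow>
     times_differentiable_on i (supp p) (lower_m p w l) \<and>
     times_differentiable_on i (supp p) (upper_m p w u) \<and>
     (\<forall>x\<in>supp p. lower_P p l (nat (j + 1)) x < \<infinity> \<and> upper_P p u (nat (j + 1)) x < \<infinity>)"

definition derivs_abs_cont_near :: "nat \<Rightarrow> real \<Rightarrow> (real \<Rightarrow> real) \<Rightarrow> bool" where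
  "derivs_abs_cont_near k x f \<longleftrightarrow>
     (\<exists>\<delta>>0. times_differentiable_on k {x - \<delta><..<x + \<delta>} f \<and>
            (\<forall>i\<le>k. locally_abs_cont_on {x - \<delta><..<x + \<delta>} ((deriv ^^ i) f)))"

text \<open>In the limits, \<open>real_of_ereal\<close> serves to let \<open>v\<close> approach end points that may be infinite.\<close>

definition kernel_hyp ::
  "'a measure \<Rightarrow> ('a \<Rightarrow> real) \<Rightarrow> (real \<Rightarrow> real) \<Rightarrow> (real \<Rightarrow> real) \<Rightarrow> ereal \<Rightarrow> ereal \<Rightarrow>
   nat \<Rightarrow> nat \<Rightarrow> (real \<Rightarrow> real) \<Rightarrow> bool"
where
  "kernel_hyp M Z p w l u i j g \<longleftrightarrow> (\<forall>x\<in>supp p.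
     (lower_P p l (j + 1) x < \<infinity> \<and> upper_P p u (j + 1) x < \<infinity>) \<and>
     (derivs_abs_cont_near (i + 1) x (lower_m p w l) \<and>
      derivs_abs_cont_near (i + 1) x (upper_m p w u)) \<and>
     (locally_abs_cont_on UNIV g \<and>
      integrable M (\<lambda>s. \<bar>kernel_K p w l u i j x (Z s) * g (Z s)\<bar>
                      + \<bar>kernel_K p w l u i (j + 1) x (Z s) * deriv g (Z s)\<bar>
                      + \<bar>kernel_K p w l u (i + 1) j x (Z s) * g (Z s)\<bar>)) \<and>
     (((\<lambda>v. g v * lP p l 1 v) \<circ> real_of_ereal) \<longlongrightarrow> 0) (at_right l) \<and>
     (((\<lambda>v. g v * lP p l (j + 1) v) \<circ> real_of_ereal) \<longlongrightarrow> 0) (at_right l) \<and>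
     (((\<lambda>v. g v * uP p u 1 v) \<circ> real_of_ereal) \<longlongrightarrow> 0) (at_left u) \<and>
     (((\<lambda>v. g v * uP p u (j + 1) v) \<circ> real_of_ereal) \<longlongrightarrow> 0) (at_left u))"

definition kernel_Lambda ::
  "(real \<Rightarrow> real) \<Rightarrow> (real \<Rightarrow> real) \<Rightarrow> ereal \<Rightarrow> ereal \<Rightarrow> (real \<Rightarrow> real) \<Rightarrow> nat \<Rightarrow> real \<Rightarrow> real \<Rightarrow> real"
where
  "kernel_Lambda p w l u \<omega> n x v =
     deriv \<omega> x * kernel_K p w l u n n x v + \<omega> x * kernel_K p w l u (n + 1) n x v"

definition fun_V ::
  "(real \<Rightarrow> real) \<Rightarrow> (real \<Rightarrow> real) \<Rightarrow> ereal \<Rightarrow> ereal \<Rightarrow> (real \<Rightarrow> real) \<Rightarrow> nat \<Rightarrow> real \<Rightarrow> real"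
where
  "fun_V p w l u \<omega> n x =
     \<bar>deriv (\<lambda>y. \<omega> y * (deriv ^^ n) (upper_m p w u) y) x\<bar> * lP p l (n + 1) x
     + \<bar>deriv (\<lambda>y. \<omega> y * (deriv ^^ n) (lower_m p w l) y) x\<bar> * uP p u (n + 1) x"

text \<open>Norm and oscillation of a function on a set \<open>A\<close>, with values in the extended reals, since
  neither is assumed finite.\<close>

definition ess_norm_on :: "real set \<Rightarrow> (real \<Rightarrow> real) \<Rightarrow> ereal" where
  "ess_norm_on A f = esssup (lebesgue_on A) (\<lambda>x. ereal \<bar>f x\<bar>)"

definition osc_on :: "real set \<Rightarrow> (real \<Rightarrow> real) \<Rightarrow> ereal" where
  "osc_on A g = (SUP x\<in>A. ereal (g x)) - (INF x\<in>A. ereal (g x))"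

end

theory Submission
  imports Defs
begin

text \<open>
  Write \<open>H\<^sub>j\<close> for the \<open>j\<close>-th derivative of \<open>h\<close>, and \<open>a\<^sub>j\<close>, \<open>b\<^sub>j\<close> for the \<open>j\<close>-th derivatives of the upper and the
  lower kernel \<open>m\<close>. With \<open>I\<^sub>j(x)\<close>, \<open>J\<^sub>j(x)\<close> the integrals of \<open>H\<^sub>j\<close> against the \<open>j\<close>-fold iterated
  lower tail on \<open>(l, x)\<close> and upper tail on \<open>(x, u)\<close>, the function \<open>(-1)^j a\<^sub>j I\<^sub>j - b\<^sub>j J\<^sub>j\<close> is the \<open>j\<close>-th derivative of
  the Stein solution: differentiating it produces \<open>H\<^sub>j / w\<close> by the identity on \<open>M^{j,j-1}\<close>, and
  integrating by parts cancels this term by the identity on \<open>M^{j+1,j}\<close>. The hypotheses concern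
  only \<open>H\<^sub>n\<close>; the integrability needed for \<open>j < n\<close> and the vanishing of the boundary terms follow by
  integrating \<open>H\<^sub>j\<close> back from \<open>H\<^sub>n\<close> with Fubini's theorem.

  Every function involved except \<open>\<omega>\<close> is differentiable everywhere on the support, so the exceptional
  null set is that of \<open>\<omega>\<close>. That an absolutely continuous function is differentiable almost
  everywhere is reduced to monotone functions by means of the total variation; for a monotone
  function one compares its Stieltjes measure with each rational multiple \<open>q\<close> of Lebesgue measure by a
  Hahn decomposition, and the Vitali covering theorem shows that at almost every point of the
  negative (positive) part the upper (lower) derivative is at most (at least) \<open>q\<close>.
\<close>

section \<open>Differentiability of absolutely continuous functions almost everywhere\<close>

text \<open>A Vitali argument. Around a point where the claim fails for
  \<open>\<epsilon> = 1 / Suc k\<close> there are arbitrarily small balls whose length is at most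
  \<open>2 * Suc k\<close> times their \<open>\<nu>\<close>-measure. Disjoint balls of this kind,
  inside an open superset of \<open>A\<close> of small \<open>\<nu>\<close>-measure, cover almost
  all such points, which therefore have arbitrarily small outer measure.\<close>

lemma AE_null_set_imp_density_zero:
  fixes \<nu> :: "real measure"
  assumes "finite_measure \<nu>" and sets: "sets \<nu> = sets borel"
    and A: "A \<in> sets borel" and null: "measure \<nu> A = 0"
  shows "AE x in lborel. x \<in> A \<longrightarrow> (\<forall>\<epsilon>>0. \<exists>d>0. \<forall>r. 0 < r \<and> r < d \<longrightarrow> measure \<nu> (cball x r) \<le> \<epsilon> * r)"
proof -
  interpret finite_measure \<nu> by fact
  define E where "E k = {x \<in> A. \<forall>d>0. \<exists>r. 0 < r \<and> r < d \<and> r / Suc k < measure \<nu> (cball x r)}" for k :: nat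
  have negl: "negligible (E k)" for k
    unfolding negligible_outer_le
  proof (intro allI impI)
    fix e :: real assume "0 < e"
    have "emeasure \<nu> A = (INF U \<in> {U. A \<subseteq> U \<and> open U}. emeasure \<nu> U)"
      by (rule outer_regular[OF sets _ A]) (simp add: emeasure_eq_measure)
    moreover have "emeasure \<nu> A = 0" by (simp add: emeasure_eq_measure null)
    \<comment> \<open>The denominator \<open>2 * Suc k\<close> compensates the factor between the
      length and the \<open>\<nu>\<close>-measure of a ball, so that the total length comes out as
      \<open>e\<close>.\<close>
    moreover have "0 < ennreal (e / (2 * real (Suc k)))" using \<open>0 < e\<close> by (simp del: of_nat_Suc)
    ultimately obtain U where U: "A \<subseteq> U" "open U" "emeasure \<nu> U < ennreal (e / (2 * real (Suc k)))"
      using Inf_less_iff[of "emeasure \<nu> ` {U. A \<subseteq> U \<and> open U}" "ennreal (e / (2 * real (Suc k)))"] by auto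
    define K where "K = {(x, r). x \<in> E k \<and> 0 < r \<and> cball x r \<subseteq> U \<and> r / Suc k < measure \<nu> (cball x r)}"
    have K: "\<exists>i. i \<in> K \<and> x \<in> cball (fst i) (snd i) \<and> snd i < d" if x: "x \<in> E k" and "0 < d" for x d
    proof -
      have "x \<in> U" using x U(1) by (auto simp: E_def)
      then obtain s where s: "0 < s" "cball x s \<subseteq> U" using U(2) open_contains_cball by blast
      have "0 < min d s" using s \<open>0 < d\<close> by simp
      then obtain r where r: "0 < r" "r < min d s" "r / Suc k < measure \<nu> (cball x r)"
        using x unfolding E_def by blast
      have "cball x r \<subseteq> cball x s" using r by (intro subset_cball) auto
      then have "(x, r) \<in> K" using r s x unfolding K_def by auto
      then show ?thesis using r by (intro exI[of _ "(x, r)"]) auto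
    qed
    have r0: "0 < snd i" if "i \<in> K" for i using that by (auto simp: K_def)
    obtain C where C: "countable C" "C \<subseteq> K"
      "pairwise (\<lambda>i j. disjnt (cball (fst i) (snd i)) (cball (fst j) (snd j))) C"
      "negligible (E k - (\<Union>i \<in> C. cball (fst i) (snd i)))"
      by (rule Vitali_covering_theorem_cballs[OF r0 K]) blast
    let ?B = "\<lambda>i. cball (fst i) (snd i) :: real set"
    have disj: "disjoint_family_on ?B C"
      using C(3) by (auto simp: disjoint_family_on_def pairwise_def disjnt_def)
    have "emeasure lborel (\<Union>(?B ` C)) = (\<integral>\<^sup>+i. emeasure lborel (?B i) \<partial>count_space C)"
      by (rule emeasure_UN_countable) (use C disj in auto)
    also have "\<dots> \<le> (\<integral>\<^sup>+i. ennreal (2 * real (Suc k)) * emeasure \<nu> (?B i) \<partial>count_space C)"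
    proof (rule nn_integral_mono, clarsimp simp del: of_nat_Suc)
      fix x r assume "(x, r) \<in> C"
      then have r: "0 < r" "r / Suc k < measure \<nu> (cball x r)" using C(2) by (auto simp: K_def)
      have "emeasure lborel (cball x r) = ennreal (2 * r)"
        using r by (simp add: cball_eq_atLeastAtMost)
      also have "2 * r \<le> 2 * real (Suc k) * measure \<nu> (cball x r)"
        using r by (simp add: field_simps del: of_nat_Suc)
      finally show "emeasure lborel (cball x r) \<le> ennreal (2 * real (Suc k)) * emeasure \<nu> (cball x r)"
        by (simp add: emeasure_eq_measure ennreal_mult'' ennreal_leI del: of_nat_Suc)
    qed
    also have "\<dots> = ennreal (2 * real (Suc k)) * (\<integral>\<^sup>+i. emeasure \<nu> (?B i) \<partial>count_space C)"
      by (rule nn_integral_cmult) auto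
    also have "(\<integral>\<^sup>+i. emeasure \<nu> (?B i) \<partial>count_space C) = emeasure \<nu> (\<Union>(?B ` C))"
      by (rule emeasure_UN_countable[symmetric]) (use C disj sets in auto)
    also have "ennreal (2 * real (Suc k)) * \<dots> \<le> ennreal (2 * real (Suc k)) * ennreal (e / (2 * real (Suc k)))"
    proof (intro mult_left_mono)
      have "emeasure \<nu> (\<Union>(?B ` C)) \<le> emeasure \<nu> U"
        using C(2) U(2) sets by (intro emeasure_mono) (fastforce simp: K_def)+
      then show "emeasure \<nu> (\<Union>(?B ` C)) \<le> ennreal (e / (2 * real (Suc k)))" using U(3) by simp
    qed simp
    also have "\<dots> = ennreal e" using \<open>0 < e\<close> by (subst ennreal_mult'[symmetric]) (auto simp del: of_nat_Suc)
    finally have le: "emeasure lborel (\<Union>(?B ` C)) \<le> ennreal e" .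
    have B: "\<Union>(?B ` C) \<in> sets lborel" using C(1) by auto
    \<comment> \<open>\<open>E k\<close> is not known to be Borel, so the part missed by the balls
      is only a Lebesgue null set; this is why the estimate moves from \<open>lborel\<close> to
      \<open>lebesgue\<close>.\<close>
    let ?N = "E k - \<Union>(?B ` C)"
    have N: "?N \<in> null_sets lebesgue" using C(4) negligible_iff_null_sets by blast
    have em: "emeasure lebesgue (\<Union>(?B ` C) \<union> ?N) = emeasure lborel (\<Union>(?B ` C))"
      using B N by (subst emeasure_Un_null_set) (auto)
    have "\<Union>(?B ` C) \<union> ?N \<in> lmeasurable"
    proof (rule fmeasurableI)
      show "\<Union>(?B ` C) \<union> ?N \<in> sets lebesgue" using B N by (intro sets.Un) (auto dest: null_setsD2)
      show "emeasure lebesgue (\<Union>(?B ` C) \<union> ?N) < \<infinity>" unfolding em using le by (simp add: order_le_less_trans)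
    qed
    moreover have "measure lebesgue (\<Union>(?B ` C) \<union> ?N) \<le> e"
      using le \<open>0 < e\<close> unfolding measure_def em by (simp add: enn2real_leI)
    ultimately show "\<exists>T. E k \<subseteq> T \<and> T \<in> lmeasurable \<and> measure lebesgue T \<le> e"
      by (intro exI[of _ "\<Union>(?B ` C) \<union> ?N"]) auto
  qed
  have "AE x in lebesgue. x \<notin> E k" for k
    using negl[of k] negligible_iff_null_sets AE_not_in by blast
  then have "AE x in lborel. \<forall>k. x \<notin> E k"
    by (simp add: AE_all_countable AE_completion_iff)
  then show ?thesis
  proof (rule AE_mp, intro AE_I2 impI allI)
    fix x and \<epsilon> :: real assume x: "\<forall>k. x \<notin> E k" "x \<in> A" "0 < \<epsilon>"
    obtain k where k: "1 / real (Suc k) < \<epsilon>" using x(3) nat_approx_posE by blast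
    obtain d where d: "d > 0" "\<And>r. 0 < r \<Longrightarrow> r < d \<Longrightarrow> measure \<nu> (cball x r) \<le> r / Suc k"
      using x(1)[rule_format, of k] x(2) unfolding E_def by (simp add: not_less del: of_nat_Suc) (meson not_le)
    have "measure \<nu> (cball x r) \<le> \<epsilon> * r" if "0 < r" "r < d" for r
    proof -
      have "r / Suc k = (1 / Suc k) * r" by simp
      also have "\<dots> \<le> \<epsilon> * r" using k that by (intro mult_right_mono) auto
      finally show ?thesis using d(2)[OF that] by simp
    qed
    then show "\<exists>d>0. \<forall>r. 0 < r \<and> r < d \<longrightarrow> measure \<nu> (cball x r) \<le> \<epsilon> * r" using d(1) by blast
  qed
qed

lemma finite_measure_interval_measure:
  fixes F :: "real \<Rightarrow> real"
  assumes mono: "\<And>x y. x \<le> y \<Longrightarrow> F x \<le> F y" and cont: "continuous_on UNIV F"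
    and bdd: "\<And>x. \<bar>F x\<bar> \<le> B"
  shows "finite_measure (interval_measure F)"
proof
  have c: "continuous (at_right a) F" for a
    using cont by (auto simp: continuous_on_eq_continuous_within intro: continuous_within_subset)
  have UN: "UNIV = (\<Union>n::nat. {- real n<..real n})"
  proof safe
    fix x :: real
    obtain n :: nat where "\<bar>x\<bar> < n" using reals_Archimedean2 by blast
    then show "x \<in> (\<Union>n::nat. {- real n<..real n})" by (intro UN_I[of n]) auto
  qed auto
  have "emeasure (interval_measure F) (\<Union>n::nat. {- real n<..real n})
      = (SUP n::nat. emeasure (interval_measure F) {- real n<..real n})"
    by (rule SUP_emeasure_incseq[symmetric]) (auto simp: incseq_def)
  also have "\<dots> \<le> ennreal (2 * B)"
  proof (rule SUP_least)
    fix n :: nat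
    have "emeasure (interval_measure F) {- real n<..real n} = ennreal (F (real n) - F (- real n))"
      by (rule emeasure_interval_measure_Ioc) (auto simp: mono c)
    also have "\<dots> \<le> ennreal (2 * B)" using bdd[of "real n"] bdd[of "- real n"] by (intro ennreal_leI) auto
    finally show "emeasure (interval_measure F) {- real n<..real n} \<le> ennreal (2 * B)" .
  qed
  also have "\<dots> < top" by simp
  finally show "emeasure (interval_measure F) (space (interval_measure F)) \<noteq> \<infinity>"
    by (simp add: UN[symmetric])
qed

text \<open>Each positive \<open>q\<close> splits the line into a Hahn set \<open>Y q\<close>, where
  the Stieltjes measure is dominated by \<open>q\<close> times Lebesgue measure, and its complement,
  where it dominates. Almost everywhere this bounds the difference quotients from above or from
  below by about \<open>q\<close>, and the derivative at \<open>x\<close> is the infimum of the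
  rational \<open>q\<close> with \<open>x \<in> Y q\<close>.\<close>

lemma mono_AE_differentiable:
  fixes F :: "real \<Rightarrow> real"
  assumes mono: "\<And>x y. x \<le> y \<Longrightarrow> F x \<le> F y" and cont: "continuous_on UNIV F"
    and bdd: "\<And>x. \<bar>F x\<bar> \<le> B"
  shows "AE x in lborel. x \<in> {a<..<b} \<longrightarrow> F field_differentiable at x"
proof -
  define \<mu> where "\<mu> = interval_measure F"
  interpret finite_measure \<mu> unfolding \<mu>_def by (rule finite_measure_interval_measure[OF assms])
  have sets[simp, measurable_cong]: "sets \<mu> = sets borel" and space[simp]: "space \<mu> = UNIV" by (simp_all add: \<mu>_def)
  have c: "continuous (at_right a) F" for a
    using cont by (auto simp: continuous_on_eq_continuous_within intro: continuous_within_subset)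
  have \<mu>: "measure \<mu> {s<..t} = F t - F s" if "s \<le> t" for s t
    unfolding \<mu>_def measure_def using that mono
    by (subst emeasure_interval_measure_Ioc) (auto simp: c)
  define Q where "Q x y = (F y - F x) / (y - x)" for x y
  \<comment> \<open>Cutting Lebesgue measure off outside \<open>{a..b}\<close> makes it finite, as
    the Hahn decomposition of two finite measures demands.\<close>
  define \<Lambda> where "\<Lambda> q = density lborel (\<lambda>x. ennreal (q * indicator {a..b} x))" for q :: real
  have sets\<Lambda>[simp, measurable_cong]: "sets (\<Lambda> q) = sets borel" and space\<Lambda>[simp]: "space (\<Lambda> q) = UNIV" for q
    by (simp_all add: \<Lambda>_def)
  have em\<Lambda>: "emeasure (\<Lambda> q) X = ennreal q * emeasure lborel (X \<inter> {a..b})" if "0 < q" "X \<in> sets borel" for q X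
  proof -
    have "emeasure (\<Lambda> q) X = (\<integral>\<^sup>+x. ennreal (q * indicator {a..b} x) * indicator X x \<partial>lborel)"
      unfolding \<Lambda>_def using that by (intro emeasure_density) auto
    also have "\<dots> = (\<integral>\<^sup>+x. ennreal q * indicator (X \<inter> {a..b}) x \<partial>lborel)"
      by (intro nn_integral_cong) (auto simp: indicator_def)
    also have "\<dots> = ennreal q * emeasure lborel (X \<inter> {a..b})"
      using that by (subst nn_integral_cmult_indicator) auto
    finally show ?thesis .
  qed
  have fin\<Lambda>: "finite_measure (\<Lambda> q)" if "0 < q" for q
    by standard (simp add: em\<Lambda>[OF that] ennreal_mult_eq_top_iff emeasure_lborel_Icc_eq)
  have m\<Lambda>: "measure (\<Lambda> q) {s<..t} = q * (t - s)" if "0 < q" "s \<le> t" "a \<le> s" "t \<le> b" for q s t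
  proof -
    have "{s<..t} \<inter> {a..b} = {s<..t}" using that by auto
    then have "emeasure (\<Lambda> q) {s<..t} = ennreal (q * (t - s))"
      using that by (simp add: em\<Lambda> ennreal_mult)
    then show ?thesis using that by (simp add: measure_def)
  qed
  have "\<exists>Y\<in>sets borel. (\<forall>X\<in>sets borel. X \<subseteq> Y \<longrightarrow> emeasure \<mu> X \<le> emeasure (\<Lambda> q) X) \<and>
      (\<forall>X\<in>sets borel. X \<inter> Y = {} \<longrightarrow> emeasure (\<Lambda> q) X \<le> emeasure \<mu> X)" if "0 < q" for q
    using finite_unsigned_Hahn_decomposition[OF fin\<Lambda>[OF that] finite_measure_axioms] by simp
  then obtain Y where Y[measurable]: "\<And>q. 0 < q \<Longrightarrow> Y q \<in> sets borel"
    and Y1: "\<And>q X. 0 < q \<Longrightarrow> X \<in> sets borel \<Longrightarrow> X \<subseteq> Y q \<Longrightarrow> emeasure \<mu> X \<le> emeasure (\<Lambda> q) X"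
    and Y2: "\<And>q X. 0 < q \<Longrightarrow> X \<in> sets borel \<Longrightarrow> X \<inter> Y q = {} \<Longrightarrow> emeasure (\<Lambda> q) X \<le> emeasure \<mu> X"
    by metis
  have Y1': "measure \<mu> X \<le> measure (\<Lambda> q) X" if "0 < q" "X \<in> sets borel" "X \<subseteq> Y q" for q X
    using Y1[OF that] fin\<Lambda>[OF that(1)] by (simp add: emeasure_eq_measure finite_measure.emeasure_eq_measure)
  have Y2': "measure (\<Lambda> q) X \<le> measure \<mu> X" if "0 < q" "X \<in> sets borel" "X \<inter> Y q = {}" for q X
    using Y2[OF that] fin\<Lambda>[OF that(1)] by (simp add: emeasure_eq_measure finite_measure.emeasure_eq_measure)
  have restr: "measure (density N (indicator A)) X = measure N (X \<inter> A)"
    if "sets N = sets borel" "A \<in> sets borel" "X \<in> sets borel" for N :: "real measure" and A X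
    using that by (simp add: measure_restricted Int_commute)
  have fin_restr: "finite_measure (density N (indicator A))"
    if "finite_measure N" "sets N = sets borel" "A \<in> sets borel" for N :: "real measure" and A
  proof (rule finite_measureI)
    have "space N = UNIV" using sets_eq_imp_space_eq[OF that(2)] by simp
    then have "emeasure (density N (indicator A)) (space N) = emeasure N A"
      using that emeasure_restricted[of A N UNIV] by simp
    then show "emeasure (density N (indicator A)) (space (density N (indicator A))) \<noteq> \<infinity>"
      using finite_measure.emeasure_finite[OF that(1)] by simp
  qed
  \<comment> \<open>The restriction of \<open>\<mu>\<close> to the complement of \<open>Y q\<close>
    gives \<open>Y q\<close> no mass, so by the density lemma it contributes at most
    \<open>\<epsilon> * r\<close> near almost every point of \<open>Y q\<close>. Within
    \<open>Y q\<close> the growth of \<open>F\<close> is at most \<open>q\<close> times the length.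
    An interval with \<open>x\<close> as an end point lies in the ball around \<open>x\<close> whose
    radius is its length.\<close>
  have upper: "AE x in lborel. x \<in> {a<..<b} \<longrightarrow> x \<in> Y q \<longrightarrow> (\<forall>\<epsilon>>0. eventually (\<lambda>y. Q x y \<le> q + \<epsilon>) (at x))"
    if q: "0 < q" for q
  proof -
    let ?\<nu> = "density \<mu> (indicator (- Y q))"
    have "AE x in lborel. x \<in> Y q \<longrightarrow> (\<forall>\<epsilon>>0. \<exists>d>0. \<forall>r. 0 < r \<and> r < d \<longrightarrow> measure ?\<nu> (cball x r) \<le> \<epsilon> * r)"
      using q Y[OF q] by (intro AE_null_set_imp_density_zero fin_restr finite_measure_axioms) (auto simp: restr)
    then show ?thesis
    proof (rule AE_mp, intro AE_I2 impI allI)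
      fix x \<epsilon> :: real assume x: "x \<in> {a<..<b}" and "0 < \<epsilon>" "x \<in> Y q"
        and "x \<in> Y q \<longrightarrow> (\<forall>\<epsilon>>0. \<exists>d>0. \<forall>r. 0 < r \<and> r < d \<longrightarrow> measure ?\<nu> (cball x r) \<le> \<epsilon> * r)"
      then obtain d where d: "0 < d" "\<And>r. 0 < r \<Longrightarrow> r < d \<Longrightarrow> measure ?\<nu> (cball x r) \<le> \<epsilon> * r" by blast
      have key: "F t - F s \<le> (q + \<epsilon>) * (t - s)"
        if "s < t" "t - s < d" "a \<le> s" "t \<le> b" "x = s \<or> x = t" for s t
      proof -
        have "{s<..t} \<subseteq> cball x (t - s)" using that by (auto simp: dist_real_def)
        then have "measure \<mu> ({s<..t} - Y q) \<le> measure \<mu> (cball x (t - s) \<inter> - Y q)"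
          using Y[OF q] by (intro finite_measure_mono) auto
        also have "\<dots> = measure ?\<nu> (cball x (t - s))" using q Y[OF q] by (subst restr) auto
        also have "\<dots> \<le> \<epsilon> * (t - s)" using that by (intro d) auto
        finally have 1: "measure \<mu> ({s<..t} - Y q) \<le> \<epsilon> * (t - s)" .
        have "measure \<mu> ({s<..t} \<inter> Y q) \<le> measure (\<Lambda> q) ({s<..t} \<inter> Y q)" using q Y[OF q] by (intro Y1') auto
        also have "\<dots> \<le> measure (\<Lambda> q) {s<..t}"
          using Y[OF q] by (intro finite_measure.finite_measure_mono[OF fin\<Lambda>[OF q]]) auto
        also have "\<dots> = q * (t - s)" using that q by (intro m\<Lambda>) auto
        finally have 2: "measure \<mu> ({s<..t} \<inter> Y q) \<le> q * (t - s)" .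
        have "F t - F s = measure \<mu> ({s<..t} \<inter> Y q) + measure \<mu> ({s<..t} - Y q)"
          using \<mu>[of s t] that Y[OF q] finite_measure_Union[of "{s<..t} \<inter> Y q" "{s<..t} - Y q"]
          by (simp add: Int_Diff_Un Int_Diff_disjoint)
        then show ?thesis using 1 2 by (simp add: algebra_simps)
      qed
      define \<delta> where "\<delta> = min d (min (x - a) (b - x))"
      have "0 < \<delta>" using x d by (auto simp: \<delta>_def)
      have "Q x y \<le> q + \<epsilon>" if "y \<noteq> x" "dist y x < \<delta>" for y
        using key[of x y] key[of y x] that x unfolding Q_def \<delta>_def
        by (cases "x < y") (auto simp: dist_real_def divide_simps algebra_simps)
      then show "eventually (\<lambda>y. Q x y \<le> q + \<epsilon>) (at x)"
        unfolding eventually_at using \<open>0 < \<delta>\<close> by blast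
    qed
  qed
  \<comment> \<open>The same argument with the two measures exchanged: now the part of
    \<open>\<Lambda> q\<close> carried by \<open>Y q\<close> has density zero at almost every point
    outside \<open>Y q\<close>.\<close>
  have lower: "AE x in lborel. x \<in> {a<..<b} \<longrightarrow> x \<notin> Y q \<longrightarrow> (\<forall>\<epsilon>>0. eventually (\<lambda>y. q - \<epsilon> \<le> Q x y) (at x))"
    if q: "0 < q" for q
  proof -
    let ?\<nu> = "density (\<Lambda> q) (indicator (Y q))"
    have "AE x in lborel. x \<in> - Y q \<longrightarrow> (\<forall>\<epsilon>>0. \<exists>d>0. \<forall>r. 0 < r \<and> r < d \<longrightarrow> measure ?\<nu> (cball x r) \<le> \<epsilon> * r)"
      using q Y[OF q] by (intro AE_null_set_imp_density_zero fin_restr fin\<Lambda>) (auto simp: restr)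
    then show ?thesis
    proof (rule AE_mp, intro AE_I2 impI allI)
      fix x \<epsilon> :: real assume x: "x \<in> {a<..<b}" and "0 < \<epsilon>" "x \<notin> Y q"
        and "x \<in> - Y q \<longrightarrow> (\<forall>\<epsilon>>0. \<exists>d>0. \<forall>r. 0 < r \<and> r < d \<longrightarrow> measure ?\<nu> (cball x r) \<le> \<epsilon> * r)"
      then obtain d where d: "0 < d" "\<And>r. 0 < r \<Longrightarrow> r < d \<Longrightarrow> measure ?\<nu> (cball x r) \<le> \<epsilon> * r" by blast
      have key: "(q - \<epsilon>) * (t - s) \<le> F t - F s"
        if "s < t" "t - s < d" "a \<le> s" "t \<le> b" "x = s \<or> x = t" for s t
      proof -
        have "{s<..t} \<subseteq> cball x (t - s)" using that by (auto simp: dist_real_def)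
        then have "measure (\<Lambda> q) ({s<..t} \<inter> Y q) \<le> measure (\<Lambda> q) (cball x (t - s) \<inter> Y q)"
          using Y[OF q] by (intro finite_measure.finite_measure_mono[OF fin\<Lambda>[OF q]]) auto
        also have "\<dots> = measure ?\<nu> (cball x (t - s))" using q Y[OF q] by (subst restr) auto
        also have "\<dots> \<le> \<epsilon> * (t - s)" using that by (intro d) auto
        finally have 1: "measure (\<Lambda> q) ({s<..t} \<inter> Y q) \<le> \<epsilon> * (t - s)" .
        have "measure (\<Lambda> q) ({s<..t} - Y q) \<le> measure \<mu> ({s<..t} - Y q)" using q Y[OF q] by (intro Y2') auto
        also have "\<dots> \<le> measure \<mu> {s<..t}"
          using Y[OF q] by (intro finite_measure_mono) auto
        also have "\<dots> = F t - F s" using that q by (intro \<mu>) auto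
        finally have 2: "measure (\<Lambda> q) ({s<..t} - Y q) \<le> F t - F s" .
        have "q * (t - s) = measure (\<Lambda> q) ({s<..t} \<inter> Y q) + measure (\<Lambda> q) ({s<..t} - Y q)"
          using m\<Lambda>[of q s t] that q Y[OF q] finite_measure.finite_measure_Union[OF fin\<Lambda>[OF q], of "{s<..t} \<inter> Y q" "{s<..t} - Y q"]
          by (simp add: Int_Diff_Un Int_Diff_disjoint)
        then show ?thesis using 1 2 by (simp add: algebra_simps)
      qed
      define \<delta> where "\<delta> = min d (min (x - a) (b - x))"
      have "0 < \<delta>" using x d by (auto simp: \<delta>_def)
      have "q - \<epsilon> \<le> Q x y" if "y \<noteq> x" "dist y x < \<delta>" for y
        using key[of x y] key[of y x] that x unfolding Q_def \<delta>_def
        by (cases "x < y") (auto simp: dist_real_def divide_simps algebra_simps)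
      then show "eventually (\<lambda>y. q - \<epsilon> \<le> Q x y) (at x)"
        unfolding eventually_at using \<open>0 < \<delta>\<close> by blast
    qed
  qed
  \<comment> \<open>\<open>D\<close> collects the points where no upper bound for the quotients is
    available. There \<open>\<mu>\<close> dominates every integer multiple of Lebesgue measure, and
    a finite \<open>\<mu>\<close> forces \<open>D\<close> to be null.\<close>
  define D where "D = {a<..<b} - (\<Union>k::nat. Y (Suc k))"
  have D[measurable]: "D \<in> sets borel" using Y by (auto simp: D_def)
  have "measure lborel D * Suc k \<le> measure \<mu> UNIV" for k :: nat
  proof -
    have D': "D \<inter> {a..b} = D" by (auto simp: D_def)
    have "measure (\<Lambda> (Suc k)) D \<le> measure \<mu> D" by (rule Y2') (auto simp: D_def)
    also have "\<dots> \<le> measure \<mu> UNIV" by (intro finite_measure_mono) auto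
    also have "measure (\<Lambda> (Suc k)) D = Suc k * measure lborel D"
      using em\<Lambda>[of "Suc k" D] D by (simp add: measure_def D' enn2real_mult del: of_nat_Suc)
    finally show ?thesis by (simp add: mult.commute)
  qed
  then have "measure lborel D \<le> 0"
  proof (rule_tac ccontr)
    assume *: "\<And>k::nat. measure lborel D * Suc k \<le> measure \<mu> UNIV" and "\<not> measure lborel D \<le> 0"
    then have pos: "0 < measure lborel D" by simp
    obtain k :: nat where "measure \<mu> UNIV / measure lborel D < k" using reals_Archimedean2 by blast
    then have "measure \<mu> UNIV < measure lborel D * Suc k" using pos by (simp add: field_simps)
    then show False using *[of k] by simp
  qed
  moreover have "emeasure lborel D < \<infinity>"
  proof -
    have "emeasure lborel D \<le> emeasure lborel {a..b}" by (intro emeasure_mono) (auto simp: D_def)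
    also have "\<dots> < \<infinity>" by (simp add: emeasure_lborel_Icc_eq)
    finally show ?thesis .
  qed
  ultimately have "D \<in> null_sets lborel"
    using measure_nonneg[of lborel D] by (intro null_setsI) (auto simp: measure_def enn2real_eq_0_iff antisym_conv)
  then have D_AE: "AE x in lborel. x \<notin> D" by (rule AE_not_in)
  have "AE x in lborel. \<forall>q\<in>{q\<in>\<rat>. 0 < q}. x \<in> {a<..<b} \<longrightarrow> x \<in> Y q \<longrightarrow> (\<forall>\<epsilon>>0. eventually (\<lambda>y. Q x y \<le> q + \<epsilon>) (at x))"
    using upper countable_rat by (subst AE_ball_countable) (auto intro: countable_subset)
  moreover have "AE x in lborel. \<forall>q\<in>{q\<in>\<rat>. 0 < q}. x \<in> {a<..<b} \<longrightarrow> x \<notin> Y q \<longrightarrow> (\<forall>\<epsilon>>0. eventually (\<lambda>y. q - \<epsilon> \<le> Q x y) (at x))"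
    using lower countable_rat by (subst AE_ball_countable) (auto intro: countable_subset)
  ultimately show ?thesis using D_AE
  proof (eventually_elim, intro impI)
    fix x assume up: "\<forall>q\<in>{q\<in>\<rat>. 0 < q}. x \<in> {a<..<b} \<longrightarrow> x \<in> Y q \<longrightarrow> (\<forall>\<epsilon>>0. eventually (\<lambda>y. Q x y \<le> q + \<epsilon>) (at x))"
      and lo: "\<forall>q\<in>{q\<in>\<rat>. 0 < q}. x \<in> {a<..<b} \<longrightarrow> x \<notin> Y q \<longrightarrow> (\<forall>\<epsilon>>0. eventually (\<lambda>y. q - \<epsilon> \<le> Q x y) (at x))"
      and "x \<notin> D" and x: "x \<in> {a<..<b}"
    define R where "R = {q\<in>\<rat>. 0 < q \<and> x \<in> Y q}"
    define c where "c = Inf R"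
    obtain k :: nat where "x \<in> Y (Suc k)" using x \<open>x \<notin> D\<close> by (auto simp: D_def)
    then have "real (Suc k) \<in> R" unfolding R_def using Rats_of_nat[of "Suc k"] by (simp del: of_nat_Suc)
    then have ne: "R \<noteq> {}" by blast
    have bb: "bdd_below R" by (rule bdd_belowI[of _ 0]) (auto simp: R_def)
    have "(Q x \<longlongrightarrow> c) (at x)"
    proof (rule tendstoI)
      fix e :: real assume "0 < e"
      then obtain q where q: "q \<in> R" "q < c + e / 3" using cInf_lessD[OF ne, of "c + e / 3"] c_def by auto
      have u: "eventually (\<lambda>y. Q x y \<le> q + e / 3) (at x)" using up q x \<open>0 < e\<close> by (auto simp: R_def)
      have l: "eventually (\<lambda>y. c - 2 * (e / 3) \<le> Q x y) (at x)"
      \<comment> \<open>A rational just below \<open>c\<close> gives the lower bound if it is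
        positive. Otherwise \<open>c\<close> is within \<open>e / 3\<close> of zero, and it suffices
        that the quotients of a monotone function are nonnegative.\<close>
      proof (cases "c - e / 3 > 0")
        case True
        obtain q' where q': "q' \<in> \<rat>" "c - e / 3 < q'" "q' < c" using Rats_dense_in_real[of "c - e / 3" c] \<open>0 < e\<close> by auto
        then have "q' \<notin> R" using cInf_lower[OF _ bb] by (force simp: c_def)
        then have "x \<notin> Y q'" using q' True by (auto simp: R_def)
        then have "eventually (\<lambda>y. q' - e / 3 \<le> Q x y) (at x)" using lo q' True x \<open>0 < e\<close> by auto
        then show ?thesis by (rule eventually_mono) (use q' in auto)
      next
        case False
        have nonneg: "0 \<le> Q x y" for y
          using mono[of x y] mono[of y x] unfolding Q_def
          by (cases "x \<le> y") (auto simp: divide_nonneg_nonneg divide_nonpos_nonpos)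
        have "c - 2 * (e / 3) \<le> Q x y" for y using nonneg[of y] False \<open>0 < e\<close> by simp
        then show ?thesis by simp
      qed
      show "eventually (\<lambda>y. dist (Q x y) c < e) (at x)"
        using u l by eventually_elim (use q \<open>0 < e\<close> in \<open>auto simp: dist_real_def\<close>)
    qed
    then have "(F has_real_derivative c) (at x)" by (simp add: has_field_derivative_iff Q_def[abs_def])
    then show "F field_differentiable at x" by (auto simp: field_differentiable_def)
  qed
qed

section \<open>Total variation of absolutely continuous functions\<close>

definition nonoverlapping_in :: "real set \<Rightarrow> nat \<Rightarrow> (nat \<Rightarrow> real) \<Rightarrow> (nat \<Rightarrow> real) \<Rightarrow> bool" where
  "nonoverlapping_in S k A B \<longleftrightarrow>
     (\<forall>i<k. A i \<le> B i \<and> {A i..B i} \<subseteq> S) \<and>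
     (\<forall>i<k. \<forall>j<k. i \<noteq> j \<longrightarrow> {A i<..<B i} \<inter> {A j<..<B j} = {})"

text \<open>Families of nonoverlapping intervals are used in place of partitions, so that the sums
  are literally those controlled by \<open>abs_cont_on\<close>.\<close>

definition total_variation :: "real \<Rightarrow> (real \<Rightarrow> real) \<Rightarrow> real \<Rightarrow> real" where
  "total_variation a f y =
     Sup {(\<Sum>i<k. \<bar>f (B i) - f (A i)\<bar>) | k A B. nonoverlapping_in {a..y} k A B}"

lemma abs_cont_on_nonoverlapping:
  assumes "abs_cont_on S f" "0 < \<epsilon>"
  obtains \<delta> where "0 < \<delta>"
    "\<And>k A B. nonoverlapping_in S k A B \<Longrightarrow> (\<Sum>i<k. B i - A i) < \<delta> \<Longrightarrow> (\<Sum>i<k. \<bar>f (B i) - f (A i)\<bar>) < \<epsilon>"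
proof -
  obtain \<delta> where \<delta>: "0 < \<delta>" "\<forall>(k::nat) A B. (\<forall>i<k. A i \<le> B i \<and> {A i..B i} \<subseteq> S) \<and>
      (\<forall>i<k. \<forall>j<k. i \<noteq> j \<longrightarrow> {A i<..<B i} \<inter> {A j<..<B j} = {}) \<and>
      (\<Sum>i<k. B i - A i) < \<delta> \<longrightarrow> (\<Sum>i<k. \<bar>f (B i) - f (A i)\<bar>) < \<epsilon>"
    using assms(1)[unfolded abs_cont_on_def, rule_format, OF assms(2)] by (elim exE conjE) (rule that)
  show thesis
  proof (rule that[OF \<delta>(1)])
    fix k A B assume "nonoverlapping_in S k A B" "(\<Sum>i<k. B i - A i) < \<delta>"
    then show "(\<Sum>i<k. \<bar>f (B i) - f (A i)\<bar>) < \<epsilon>"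
      using \<delta>(2)[rule_format, of k A B] unfolding nonoverlapping_in_def by simp
  qed
qed

lemma nonoverlapping_in_subset: "nonoverlapping_in S k A B \<Longrightarrow> S \<subseteq> T \<Longrightarrow> nonoverlapping_in T k A B"
  unfolding nonoverlapping_in_def by blast

text \<open>The left side is the Lebesgue measure of the disjoint union of the open
  intervals.\<close>

lemma nonoverlapping_in_sum_le:
  assumes "nonoverlapping_in {a..b} k A B" "a \<le> b"
  shows "(\<Sum>i<k. B i - A i) \<le> b - a"
proof -
  have *: "A i \<le> B i" "{A i<..<B i} \<subseteq> {a..b}" if "i < k" for i
    using assms that unfolding nonoverlapping_in_def by (auto simp: subset_iff)
  have "ennreal (\<Sum>i<k. B i - A i) = (\<Sum>i<k. emeasure lborel {A i<..<B i})"
    using * by (subst sum_ennreal[symmetric]) auto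
  also have "\<dots> = emeasure lborel (\<Union>i<k. {A i<..<B i})"
    using assms by (intro sum_emeasure) (auto simp: disjoint_family_on_def nonoverlapping_in_def)
  also have "\<dots> \<le> emeasure lborel {a..b}"
    using * by (intro emeasure_mono) auto
  finally show ?thesis using assms(2) by (simp add: ennreal_le_iff)
qed

lemma abs_cont_on_imp_continuous_on:
  assumes "abs_cont_on {a..b} f"
  shows "continuous_on {a..b} f"
  unfolding continuous_on_iff
proof (intro ballI allI impI)
  fix x e :: real assume x: "x \<in> {a..b}" "0 < e"
  obtain d where d: "0 < d" "\<And>k A B. nonoverlapping_in {a..b} k A B \<Longrightarrow> (\<Sum>i<k. B i - A i) < d
      \<Longrightarrow> (\<Sum>i<k. \<bar>f (B i) - f (A i)\<bar>) < e"
    using abs_cont_on_nonoverlapping[OF assms x(2)] by blast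
  have close: "\<bar>f t - f s\<bar> < e" if "a \<le> s" "s \<le> t" "t \<le> b" "t - s < d" for s t
    using d(2)[of 1 "\<lambda>_. s" "\<lambda>_. t"] that by (auto simp: nonoverlapping_in_def)
  have "dist (f y) (f x) < e" if "y \<in> {a..b}" "dist y x < d" for y
    using close[of x y] close[of y x] that x
    by (cases "x \<le> y") (auto simp: dist_real_def abs_minus_commute)
  then show "\<exists>d>0. \<forall>x'\<in>{a..b}. dist x' x < d \<longrightarrow> dist (f x') (f x) < e" using d(1) by blast
qed

lemma locally_abs_cont_on_imp_isCont:
  assumes "locally_abs_cont_on S f" "open S" "x \<in> S"
  shows "isCont f x"
proof -
  obtain e where e: "e > 0" "cball x e \<subseteq> S" using assms open_contains_cball by blast
  then have "abs_cont_on {x - e..x + e} f"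
    using assms(1) by (auto simp: locally_abs_cont_on_def cball_eq_atLeastAtMost)
  then have "continuous_on {x - e..x + e} f" by (rule abs_cont_on_imp_continuous_on)
  then show ?thesis using e(1) by (intro continuous_on_interior[of "{x - e..x + e}"]) auto
qed

text \<open>The bound 1 keeps the suprema in \<open>total_variation\<close> finite. On an interval
  shorter than the \<open>\<delta>\<close> that absolute continuity supplies for
  \<open>\<epsilon> = 1\<close> it holds automatically.\<close>

context
  fixes a b :: real and f :: "real \<Rightarrow> real"
  assumes ab: "a \<le> b" and AC: "abs_cont_on {a..b} f"
    and bounded: "\<And>k A B. nonoverlapping_in {a..b} k A B \<Longrightarrow> (\<Sum>i<k. \<bar>f (B i) - f (A i)\<bar>) \<le> 1"
begin

abbreviation "variation_sums y \<equiv> {(\<Sum>i<k. \<bar>f (B i) - f (A i)\<bar>) | k A B. nonoverlapping_in {a..y} k A B}"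

lemma variation_sums_bdd: "y \<le> b \<Longrightarrow> bdd_above (variation_sums y)"
  by (rule bdd_aboveI[of _ 1]) (auto intro!: bounded elim!: nonoverlapping_in_subset)

lemma variation_sums_nonempty: "variation_sums y \<noteq> {}"
proof -
  have "nonoverlapping_in {a..y} 0 (\<lambda>_. 0) (\<lambda>_. 0)" by (simp add: nonoverlapping_in_def)
  then show ?thesis by blast
qed

lemma total_variation_upper:
  "nonoverlapping_in {a..y} k A B \<Longrightarrow> y \<le> b \<Longrightarrow> (\<Sum>i<k. \<bar>f (B i) - f (A i)\<bar>) \<le> total_variation a f y"
  unfolding total_variation_def by (rule cSup_upper[OF _ variation_sums_bdd]) auto

text \<open>Any family in \<open>{a..x}\<close> can be enlarged by the single interval
  \<open>{x..y}\<close>.\<close>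

lemma total_variation_increment:
  assumes "a \<le> x" "x \<le> y" "y \<le> b"
  shows "total_variation a f x + \<bar>f y - f x\<bar> \<le> total_variation a f y"
proof -
  have "total_variation a f x \<le> total_variation a f y - \<bar>f y - f x\<bar>"
    unfolding total_variation_def[of a f x]
  proof (rule cSup_least[OF variation_sums_nonempty], clarify)
    fix k A B assume no: "nonoverlapping_in {a..x} k A B"
    let ?A = "A(k := x)" and ?B = "B(k := y)"
    have le: "a \<le> A i" "A i \<le> B i" "B i \<le> x" if "i < k" for i
      using no that unfolding nonoverlapping_in_def by (auto simp: subset_iff)
    have d: "{A i<..<B i} \<inter> {A j<..<B j} = {}" if "i < k" "j < k" "i \<noteq> j" for i j
      using no that unfolding nonoverlapping_in_def by auto
    have d1: "{A i<..<B i} \<inter> {x<..<y} = {}" if "i < k" for i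
      using le[OF that] by (auto simp: disjoint_iff)
    have "nonoverlapping_in {a..y} (Suc k) ?A ?B"
      unfolding nonoverlapping_in_def
    proof (intro conjI allI impI)
      fix i assume "i < Suc k"
      then show "?A i \<le> ?B i" "{?A i..?B i} \<subseteq> {a..y}" using le[of i] assms by auto
      fix j assume "j < Suc k" "i \<noteq> j"
      then show "{?A i<..<?B i} \<inter> {?A j<..<?B j} = {}"
        using \<open>i < Suc k\<close> d[of i j] d1[of i] d1[of j] by (cases "i = k"; cases "j = k") (auto simp: Int_commute)
    qed
    from total_variation_upper[OF this assms(3)]
    show "(\<Sum>i<k. \<bar>f (B i) - f (A i)\<bar>) \<le> total_variation a f y - \<bar>f y - f x\<bar>" by simp
  qed
  then show ?thesis by simp
qed

text \<open>Every interval of a family in \<open>{a..t}\<close> is cut at \<open>s\<close>. The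
  lower pieces contribute at most the variation up to \<open>s\<close>; the upper pieces lie in
  \<open>{s..t}\<close>, have small total length, and absolute continuity bounds their
  contribution.\<close>

lemma total_variation_continuous: "continuous_on {a..b} (total_variation a f)"
  unfolding continuous_on_iff
proof (intro ballI allI impI)
  fix x e :: real assume x: "x \<in> {a..b}" "0 < e"
  let ?V = "total_variation a f"
  obtain d where d: "0 < d" "\<And>k A B. nonoverlapping_in {a..b} k A B \<Longrightarrow> (\<Sum>i<k. B i - A i) < d
      \<Longrightarrow> (\<Sum>i<k. \<bar>f (B i) - f (A i)\<bar>) < e / 2"
    using abs_cont_on_nonoverlapping[OF AC, of "e / 2"] x(2) by auto
  have V: "?V t \<le> ?V s + e / 2" if "a \<le> s" "s \<le> t" "t \<le> b" "t - s < d" for s t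
    unfolding total_variation_def[of a f t]
  proof (rule cSup_least[OF variation_sums_nonempty], clarify)
    fix k A B assume no: "nonoverlapping_in {a..t} k A B"
    have le: "a \<le> A i" "A i \<le> B i" "B i \<le> t" if "i < k" for i
      using no that unfolding nonoverlapping_in_def by (auto simp: subset_iff)
    have disj: "{A i<..<B i} \<inter> {A j<..<B j} = {}" if "i < k" "j < k" "i \<noteq> j" for i j
      using no that unfolding nonoverlapping_in_def by auto
    \<comment> \<open>Clipping with \<open>min\<close> and \<open>max\<close> keeps the index set:
      an interval on the wrong side of \<open>s\<close> degenerates to the point \<open>s\<close>
      and contributes zero.\<close>
    have lo: "nonoverlapping_in {a..s} k (\<lambda>i. min (A i) s) (\<lambda>i. min (B i) s)"
      unfolding nonoverlapping_in_def
    proof (intro conjI allI impI)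
      fix i assume i: "i < k"
      show "min (A i) s \<le> min (B i) s" "{min (A i) s..min (B i) s} \<subseteq> {a..s}"
        using le[OF i] that by auto
      fix j assume j: "j < k" "i \<noteq> j"
      have "{min (A i) s<..<min (B i) s} \<subseteq> {A i<..<B i}" for i by auto
      then show "{min (A i) s<..<min (B i) s} \<inter> {min (A j) s<..<min (B j) s} = {}"
        using disj[OF i j] by blast
    qed
    have hi: "nonoverlapping_in {s..t} k (\<lambda>i. max (A i) s) (\<lambda>i. max (B i) s)"
      unfolding nonoverlapping_in_def
    proof (intro conjI allI impI)
      fix i assume i: "i < k"
      show "max (A i) s \<le> max (B i) s" "{max (A i) s..max (B i) s} \<subseteq> {s..t}"
        using le[OF i] that by auto
      fix j assume j: "j < k" "i \<noteq> j"
      have "{max (A i) s<..<max (B i) s} \<subseteq> {A i<..<B i}" for i by auto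
      then show "{max (A i) s<..<max (B i) s} \<inter> {max (A j) s<..<max (B j) s} = {}"
        using disj[OF i j] by blast
    qed
    have "(\<Sum>i<k. \<bar>f (B i) - f (A i)\<bar>)
        \<le> (\<Sum>i<k. \<bar>f (min (B i) s) - f (min (A i) s)\<bar> + \<bar>f (max (B i) s) - f (max (A i) s)\<bar>)"
    proof (rule sum_mono)
      fix i assume "i \<in> {..<k}"
      then have "A i \<le> B i" using le by simp
      then show "\<bar>f (B i) - f (A i)\<bar> \<le> \<bar>f (min (B i) s) - f (min (A i) s)\<bar> + \<bar>f (max (B i) s) - f (max (A i) s)\<bar>"
        by (cases "B i \<le> s"; cases "A i \<le> s") (auto simp: min_def max_def)
    qed
    also have "\<dots> = (\<Sum>i<k. \<bar>f (min (B i) s) - f (min (A i) s)\<bar>) + (\<Sum>i<k. \<bar>f (max (B i) s) - f (max (A i) s)\<bar>)"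
      by (rule sum.distrib)
    also have "(\<Sum>i<k. \<bar>f (min (B i) s) - f (min (A i) s)\<bar>) \<le> ?V s"
      using total_variation_upper[OF lo] that by simp
    also have "(\<Sum>i<k. \<bar>f (max (B i) s) - f (max (A i) s)\<bar>) < e / 2"
      using nonoverlapping_in_sum_le[OF hi] that
      by (intro d nonoverlapping_in_subset[OF hi]) auto
    finally show "(\<Sum>i<k. \<bar>f (B i) - f (A i)\<bar>) \<le> ?V s + e / 2" by simp
  qed
  have "dist (?V y) (?V x) < e" if "y \<in> {a..b}" "dist y x < d" for y
    using that x V[of x y] V[of y x] total_variation_increment[of x y] total_variation_increment[of y x]
    by (cases "x \<le> y") (auto simp: dist_real_def)
  then show "\<exists>d>0. \<forall>x'\<in>{a..b}. dist x' x < d \<longrightarrow> dist (?V x') (?V x) < e" using d(1) by blast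
qed

text \<open>With \<open>V\<close> the total variation, \<open>V + f\<close> and \<open>V - f\<close>
  are continuous and increasing, hence differentiable almost everywhere, and \<open>f\<close> is
  half of their difference.\<close>

lemma abs_cont_on_AE_differentiable:
  "AE x in lborel. x \<in> {a<..<b} \<longrightarrow> f field_differentiable at x"
proof -
  \<comment> \<open>The clamp \<open>?c\<close> extends the functions from \<open>{a..b}\<close> to
    bounded monotone functions on the whole line without changing them on the open interval.\<close>
  let ?V = "total_variation a f" and ?c = "\<lambda>t. max a (min b t)"
  have AE: "AE x in lborel. x \<in> {a<..<b} \<longrightarrow> (\<lambda>t. ?V (?c t) + \<sigma> * f (?c t)) field_differentiable at x"
    if \<sigma>: "\<sigma> = 1 \<or> \<sigma> = -1" for \<sigma> :: real
  proof -
    let ?G = "\<lambda>t. ?V t + \<sigma> * f t"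
    have mono: "?G s \<le> ?G t" if "a \<le> s" "s \<le> t" "t \<le> b" for s t
      using total_variation_increment[OF that] \<sigma> by auto
    have "continuous_on {a..b} ?G"
      by (intro continuous_intros total_variation_continuous abs_cont_on_imp_continuous_on AC)
    then have "continuous_on UNIV (\<lambda>t. ?G (?c t))"
      by (rule continuous_on_compose2) (use ab in \<open>auto intro!: continuous_intros\<close>)
    moreover have "\<bar>?G (?c t)\<bar> \<le> \<bar>?G a\<bar> + \<bar>?G b\<bar>" for t
    proof -
      have "?G a \<le> ?G (?c t)" "?G (?c t) \<le> ?G b" using ab by (auto intro!: mono)
      then show ?thesis by (smt (verit))
    qed
    moreover have "?G (?c s) \<le> ?G (?c t)" if "s \<le> t" for s t
      using that ab by (intro mono) auto
    ultimately show ?thesis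
      by (intro mono_AE_differentiable[where B = "\<bar>?G a\<bar> + \<bar>?G b\<bar>"])
  qed
  show ?thesis
    using AE[of 1, OF disjI1[OF refl]] AE[of "-1", OF disjI2[OF refl]]
  proof (eventually_elim, intro impI)
    fix x assume "x \<in> {a<..<b} \<longrightarrow> (\<lambda>t. ?V (?c t) + 1 * f (?c t)) field_differentiable at x"
      "x \<in> {a<..<b} \<longrightarrow> (\<lambda>t. ?V (?c t) + -1 * f (?c t)) field_differentiable at x"
      and x: "x \<in> {a<..<b}"
    then have "(\<lambda>t. (1/2) * ((?V (?c t) + 1 * f (?c t)) - (?V (?c t) + -1 * f (?c t)))) field_differentiable at x"
      by (intro field_differentiable_mult field_differentiable_diff field_differentiable_const) auto
    then have D: "(\<lambda>t. f (?c t)) field_differentiable at x" by simp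
    then obtain D where "((\<lambda>t. f (?c t)) has_field_derivative D) (at x)" by (auto simp: field_differentiable_def)
    then have "(f has_field_derivative D) (at x)"
      by (rule has_field_derivative_transform_within_open[of _ _ _ "{a<..<b}"]) (use x in auto)
    then show "f field_differentiable at x" by (auto simp: field_differentiable_def)
  qed
qed

end

text \<open>Negligibility is a local property, so it suffices to treat an interval around each point
  that is so short that its variation sums are at most 1.\<close>

theorem locally_abs_cont_on_AE_differentiable:
  assumes "open S" "locally_abs_cont_on S f"
  shows "AE x in lborel. x \<in> S \<longrightarrow> f field_differentiable at x"
proof -
  define N where "N = {x \<in> S. \<not> f field_differentiable at x}"
  have "negligible N"
  proof (rule iffD2[OF locally_negligible_alt], rule ballI)
    fix x assume "x \<in> N"
    then have "x \<in> S" by (simp add: N_def)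
    then obtain e where e: "0 < e" "cball x e \<subseteq> S" using assms(1) open_contains_cball by blast
    then have "abs_cont_on {x - e..x + e} f"
      using assms(2) by (auto simp: locally_abs_cont_on_def cball_eq_atLeastAtMost)
    then obtain d where d: "0 < d" "\<And>k A B. nonoverlapping_in {x - e..x + e} k A B \<Longrightarrow> (\<Sum>i<k. B i - A i) < d
      \<Longrightarrow> (\<Sum>i<k. \<bar>f (B i) - f (A i)\<bar>) < 1"
      by (rule abs_cont_on_nonoverlapping[of _ f 1]) (simp, blast)
    \<comment> \<open>The interval has length \<open>2 * r\<close>, which \<open>d / 3\<close> keeps
      strictly below \<open>d\<close>.\<close>
    define r where "r = min e (d / 3)"
    have r: "0 < r" "r \<le> e" "2 * r < d" using e d by (auto simp: r_def)
    have sub: "{x - r..x + r} \<subseteq> {x - e..x + e}" using r by auto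
    have "AE y in lborel. y \<in> {x - r<..<x + r} \<longrightarrow> f field_differentiable at y"
    proof (rule abs_cont_on_AE_differentiable)
      show "x - r \<le> x + r" using r by simp
      have "{x - r..x + r} \<subseteq> S" using e(2) sub by (auto simp: cball_eq_atLeastAtMost)
      then show "abs_cont_on {x - r..x + r} f"
        using assms(2) r(1) unfolding locally_abs_cont_on_def by simp
      show "(\<Sum>i<k. \<bar>f (B i) - f (A i)\<bar>) \<le> 1" if "nonoverlapping_in {x - r..x + r} k A B" for k A B
        using d(2)[OF nonoverlapping_in_subset[OF that sub]] nonoverlapping_in_sum_le[OF that] r by simp
    qed
    then have "AE y in lebesgue. y \<notin> N \<inter> {x - r<..<x + r}"
      unfolding AE_completion_iff by (rule AE_mp) (auto simp: N_def)
    then have "negligible (N \<inter> {x - r<..<x + r})"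
      by (simp add: negligible_iff_null_sets completion.null_sets_iff_AE)
    moreover have "openin (top_of_set N) (N \<inter> {x - r<..<x + r})" by (simp add: openin_open_Int)
    ultimately show "\<exists>U. openin (top_of_set N) U \<and> x \<in> U \<and> negligible U"
      using r \<open>x \<in> N\<close> by (intro exI[of _ "N \<inter> {x - r<..<x + r}"]) auto
  qed
  then have "AE x in lebesgue. x \<notin> N"
    using negligible_iff_null_sets AE_not_in by blast
  then show ?thesis unfolding AE_completion_iff by (rule AE_mp) (auto simp: N_def)
qed

section \<open>Iterated tails\<close>

text \<open>Since \<open>l\<close> may be infinite, the integral up to a fixed \<open>a < x\<close>
  is split off as a constant; the rest is the fundamental theorem of calculus on the compact
  interval \<open>{a..c}\<close>.\<close>

lemma has_real_derivative_LBINT_upper_limit: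
  fixes G :: "real \<Rightarrow> real" and l :: ereal
  assumes int: "set_integrable lborel (einterval l (ereal b)) G"
    and x: "l < ereal x" "x < b" and cont: "isCont G x"
  shows "((\<lambda>y. LBINT t:einterval l (ereal y). G t) has_real_derivative G x) (at x)"
proof -
  obtain a where a: "l < ereal a" "a < x" using ereal_dense2[OF x(1)] by auto
  obtain c where c: "x < c" "c < b" using dense[OF x(2)] by auto
  have sub: "set_integrable lborel S G" if "S \<subseteq> einterval l (ereal b)" "S \<in> sets borel" for S
    using that by (intro set_integrable_subset[OF int]) auto
  have lt: "l < ereal y" if "a \<le> y" for y
    using a(1) that by (meson ereal_less_eq(3) less_le_trans)
  have intc: "G integrable_on {a..c}"
    using lt c by (intro set_borel_integral_eq_integral sub) (auto simp: einterval_iff)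
  have eq: "(LBINT t:einterval l (ereal y). G t) = (LBINT t:einterval l (ereal a). G t) + integral {a..y} G"
    if y: "y \<in> {a<..<c}" for y
  proof -
    have "einterval l (ereal y) = einterval l (ereal a) \<union> {a..<y}"
      using y lt by (auto simp: einterval_iff not_less)
    then have "(LBINT t:einterval l (ereal y). G t) = (LBINT t:einterval l (ereal a). G t) + (LBINT t:{a..<y}. G t)"
      using y c lt by (auto intro!: set_integral_Un sub simp: einterval_iff)
    also have "(LBINT t:{a..<y}. G t) = integral {a..<y} G"
      using lt c y by (intro set_borel_integral_eq_integral sub) (auto simp: einterval_iff)
    also have "\<dots> = integral {a..y} G"
      by (rule integral_subset_negligible) (auto intro: negligible_subset[of "{y}"])
    finally show ?thesis .
  qed
  have "((\<lambda>u. integral {a..u} G) has_vector_derivative G x) (at x within {a..c})"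
    using integral_has_vector_derivative_continuous_at[OF intc, of x "{}"] cont a c
    by (auto intro: continuous_at_imp_continuous_within)
  then have "((\<lambda>u. integral {a..u} G) has_real_derivative G x) (at x)"
    using a c by (simp add: has_real_derivative_iff_has_vector_derivative at_within_Icc_at)
  then have "((\<lambda>y. (LBINT t:einterval l (ereal a). G t) + integral {a..y} G) has_real_derivative 0 + G x) (at x)"
    by (intro DERIV_add DERIV_const)
  then have "((\<lambda>y. (LBINT t:einterval l (ereal a). G t) + integral {a..y} G) has_real_derivative G x) (at x)"
    by simp
  then show ?thesis
    by (rule has_field_derivative_transform_within_open[where S = "{a<..<c}"]) (use a c in \<open>auto simp: eq\<close>)
qed

text \<open>Fubini on \<open>{(t, s). t < s < x}\<close> replaces the boundary terms of the integration by parts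
  at \<open>l\<close>: only absolute convergence of the right-hand side is needed.\<close>

lemma LBINT_by_parts_lower:
  fixes G g g' :: "real \<Rightarrow> real" and l :: ereal
  defines "H \<equiv> \<lambda>s. LBINT t:einterval l (ereal s). G t"
  assumes G[measurable]: "G \<in> borel_measurable borel" and nonneg: "\<And>t. 0 \<le> G t"
    and int: "set_integrable lborel (einterval l (ereal x)) G"
    and g: "\<And>t. (g has_real_derivative g' t) (at t)" and g': "continuous_on UNIV g'"
    and int': "set_integrable lborel (einterval l (ereal x)) (\<lambda>s. g' s * H s)"
  shows "set_integrable lborel (einterval l (ereal x)) (\<lambda>t. g t * G t)"
    and "(LBINT t:einterval l (ereal x). g t * G t) = g x * H x - (LBINT s:einterval l (ereal x). g' s * H s)"
proof -
  have [measurable]: "g' \<in> borel_measurable borel" using g' by (rule borel_measurable_continuous_onI)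
  define k where "k s t = (if l < ereal t \<and> t < s \<and> s < x then g' s * G t else 0)" for s t
  have k_meas: "case_prod k \<in> borel_measurable (lborel \<Otimes>\<^sub>M lborel)"
    unfolding k_def by measurable
  have kt: "k s t = indicator (einterval l x) s * g' s * (indicator (einterval l s) t * G t)" for s t
    using less_trans[of l "ereal t" "ereal s"] by (auto simp: k_def einterval_iff indicator_def)
  have ks: "k s t = indicator (einterval l x) t * G t * (indicator {t<..<x} s * g' s)" for s t
    by (auto simp: k_def einterval_iff indicator_def) 
  have int_s: "set_integrable lborel (einterval l s) G" if "s \<le> x" for s
    using that by (intro set_integrable_subset[OF int]) (auto simp: einterval_iff intro: less_le_trans)
  have inner: "integrable lborel (k s)" for s
  proof (cases "s < x")
    case True
    then show ?thesis using int_s[of s] unfolding kt[abs_def] set_integrable_def by simp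
  next
    case False
    then have "k s = (\<lambda>t. 0)" by (auto simp: k_def)
    then show ?thesis by simp
  qed
  \<comment> \<open>As \<open>G\<close> is nonnegative, integrating the absolute value of
    \<open>k\<close> over \<open>t\<close> gives \<open>\<bar>g' s\<bar> * H s\<close>. Thus
    \<open>int'\<close> is exactly the absolute convergence that Fubini's theorem requires.\<close>
  have norm_inner: "(LBINT t. norm (k s t)) = norm (indicator (einterval l x) s * (g' s * H s))" for s
  proof -
    have "(LBINT t. norm (k s t)) = (LBINT t. (indicator (einterval l x) s * \<bar>g' s\<bar>) * (indicator (einterval l s) t *\<^sub>R G t))"
      unfolding kt using nonneg by (intro Bochner_Integration.integral_cong) (auto simp: abs_mult indicator_def)
    also have "\<dots> = (indicator (einterval l x) s * \<bar>g' s\<bar>) * H s"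
      unfolding H_def set_lebesgue_integral_def by (rule integral_mult_right_zero)
    also have "\<dots> = norm (indicator (einterval l x) s * (g' s * H s))"
      using nonneg unfolding H_def set_lebesgue_integral_def
      by (subst abs_of_nonneg[symmetric, of "LBINT t. indicator (einterval l s) t *\<^sub>R G t"])
        (auto intro!: integral_nonneg simp: abs_mult indicator_def)
    finally show ?thesis .
  qed
  have "integrable (lborel \<Otimes>\<^sub>M lborel) (case_prod k)"
  proof (rule lborel_pair.Fubini_integrable[OF k_meas])
    show "integrable lborel (\<lambda>s. LBINT t. norm (case_prod k (s, t)))"
      using int' unfolding set_integrable_def by (simp add: norm_inner del: real_norm_def norm_mult) 
    show "AE s in lborel. integrable lborel (\<lambda>t. case_prod k (s, t))" using inner by simp
  qed
  note k_int = this
  have swap: "(LBINT t. LBINT s. k s t) = (LBINT s. LBINT t. k s t)"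
    by (rule lborel_pair.Fubini_integral[OF k_int])
  have I1: "(LBINT t. k s t) = indicator (einterval l x) s *\<^sub>R (g' s * H s)" for s
    unfolding kt H_def set_lebesgue_integral_def by (simp add: mult.assoc)
  have I2: "(LBINT s. k s t) = indicator (einterval l x) t *\<^sub>R (G t * (g x - g t))" for t
  proof (cases "t < x")
    case True
    have "(LBINT s=ereal t..ereal x. g' s) = g x - g t"
      using True g g' by (intro interval_integral_FTC_finite)
        (auto intro: continuous_on_subset has_field_derivative_at_within
          simp: has_real_derivative_iff_has_vector_derivative[symmetric])
    then have "(LBINT s. indicator {t<..<x} s * g' s) = g x - g t"
      using True by (simp add: interval_lebesgue_integral_def set_lebesgue_integral_def)
    then show ?thesis unfolding ks by simp
  next
    case False
    then show ?thesis unfolding ks by (simp add: einterval_iff)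
  qed
  have "integrable lborel (\<lambda>t. LBINT s. k s t)" by (rule lborel_pair.integrable_snd[OF k_int])
  then have si: "set_integrable lborel (einterval l x) (\<lambda>t. G t * (g x - g t))"
    unfolding I2 set_integrable_def .
  have eq: "g t * G t = g x * G t - G t * (g x - g t)" for t by (simp add: algebra_simps)
  have si2: "set_integrable lborel (einterval l x) (\<lambda>t. g x * G t)" using int by simp
  show "set_integrable lborel (einterval l (ereal x)) (\<lambda>t. g t * G t)"
    unfolding eq by (rule set_integral_diff(1)[OF si2 si])
  have "(LBINT t:einterval l (ereal x). g t * G t)
      = (LBINT t:einterval l (ereal x). g x * G t) - (LBINT t:einterval l (ereal x). G t * (g x - g t))"
    unfolding eq by (rule set_integral_diff(2)[OF si2 si])
  also have "(LBINT t:einterval l (ereal x). g x * G t) = g x * H x" unfolding H_def by simp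
  also have "(LBINT t:einterval l (ereal x). G t * (g x - g t)) = (LBINT s:einterval l (ereal x). g' s * H s)"
    using swap unfolding I1 I2 set_lebesgue_integral_def .
  finally show "(LBINT t:einterval l (ereal x). g t * G t) = g x * H x - (LBINT s:einterval l (ereal x). g' s * H s)" .
qed

section \<open>Measurability of the tails, and reflection exchanging upper and lower tails\<close>

lemma reflect_einterval_iff: "t \<in> einterval (- u) (ereal (- x)) \<longleftrightarrow> - t \<in> einterval (ereal x) u"
  using ereal_uminus_less_reorder[of u "ereal t"] by (auto simp: einterval_iff)

lemma set_integral_reflect_einterval:
  fixes \<phi> :: "real \<Rightarrow> real"
  shows "set_integrable lborel (einterval (- u) (ereal (- x))) (\<lambda>t. \<phi> (- t)) \<longleftrightarrow> set_integrable lborel (einterval (ereal x) u) \<phi>"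
    and "(LBINT t:einterval (- u) (ereal (- x)). \<phi> (- t)) = (LBINT t:einterval (ereal x) u. \<phi> t)"
proof -
  have i: "indicator (einterval (- u) (ereal (- x))) t = (indicator (einterval (ereal x) u) (- t) :: real)" for t :: real
    by (simp add: indicator_def reflect_einterval_iff)
  show "set_integrable lborel (einterval (- u) (ereal (- x))) (\<lambda>t. \<phi> (- t)) \<longleftrightarrow> set_integrable lborel (einterval (ereal x) u) \<phi>"
    unfolding set_integrable_def i
    using lborel_integrable_real_affine_iff[of "-1" "\<lambda>t. indicator (einterval (ereal x) u) t *\<^sub>R \<phi> t" 0] by simp
  show "(LBINT t:einterval (- u) (ereal (- x)). \<phi> (- t)) = (LBINT t:einterval (ereal x) u. \<phi> t)"
    unfolding set_lebesgue_integral_def i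
    using lborel_integral_real_affine[of "-1" "\<lambda>t. indicator (einterval (ereal x) u) t *\<^sub>R \<phi> t" 0] by simp
qed

lemma lower_P_measurable:
  assumes [measurable]: "p \<in> borel_measurable borel"
  shows "lower_P p l j \<in> borel_measurable borel"
proof (induction j)
  case (Suc j)
  note [measurable] = Suc
  have "(\<lambda>(x, t). lower_P p l j t * (if l < ereal t \<and> t < x then 1 else 0)) \<in> borel_measurable (borel \<Otimes>\<^sub>M lborel)"
    by measurable
  then have "(\<lambda>x. \<integral>\<^sup>+t. lower_P p l j t * (if l < ereal t \<and> t < x then 1 else 0) \<partial>lborel) \<in> borel_measurable borel"
    by (rule lborel.borel_measurable_nn_integral)
  moreover have "(if l < ereal t \<and> t < x then 1 else 0) = (indicator (einterval l (ereal x)) t :: ennreal)" for x t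
    by (simp add: indicator_def einterval_iff)
  ultimately show ?case by simp
qed simp

text \<open>Through this identity all statements on upper tails are obtained from those on lower
  tails, applied to the reflected density on \<open>(- u, - l)\<close>.\<close>

lemma upper_P_reflect:
  assumes [measurable]: "p \<in> borel_measurable borel"
  shows "upper_P p u j x = lower_P (\<lambda>t. p (- t)) (- u) j (- x)"
proof (induction j arbitrary: x)
  case (Suc j)
  have [measurable]: "lower_P (\<lambda>t. p (- t)) (- u) j \<in> borel_measurable borel" by (rule lower_P_measurable) measurable
  have i: "indicator (einterval (- u) (ereal (- x))) t = (indicator (einterval (ereal x) u) (- t) :: ennreal)" for t :: real
    by (simp add: indicator_def reflect_einterval_iff)
  show ?case
    using nn_integral_real_affine[of "\<lambda>t. lower_P (\<lambda>t. p (- t)) (- u) j t * indicator (einterval (- u) (ereal (- x))) t" "-1" 0]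
    by (simp add: Suc i)
qed simp

lemma uP_reflect:
  "p \<in> borel_measurable borel \<Longrightarrow> uP p u j x = lP (\<lambda>t. p (- t)) (- u) j (- x)"
  by (simp add: uP_def lP_def upper_P_reflect)

section \<open>Finiteness, positivity and differentiation of iterated lower tails\<close>

lemma not_AE_not_in_Ioo: "a < b \<Longrightarrow> \<not> (AE t in lborel. t \<notin> {a<..<b})" for a b :: real
  by (subst AE_iff_measurable[of "{a<..<b}"]) auto

lemma ereal_le_less_trans: "t \<le> x \<Longrightarrow> ereal x < u \<Longrightarrow> ereal t < u"
  by (meson ereal_less_eq(3) le_less_trans)

text \<open>These are the properties of the density that one side of the argument uses; the locale
  is instantiated with \<open>p\<close> and with its reflection. \<open>supp_cofinal\<close> allows
  a point lying between two pieces of the support to be compared with a support point to its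
  right.\<close>

locale lower_tail =
  fixes p :: "real \<Rightarrow> real" and l u :: ereal and n :: nat
  assumes p_measurable[measurable]: "p \<in> borel_measurable borel"
    and p_nonneg: "0 \<le> p x"
    and open_supp: "open (supp p)"
    and p_cont: "x \<in> supp p \<Longrightarrow> isCont p x"
    and supp_subset: "supp p \<subseteq> einterval l u"
    and supp_cofinal: "ereal x < u \<Longrightarrow> \<exists>y\<in>supp p. x < y"
    and AE_supp: "AE x in lborel. x \<in> einterval l u \<longrightarrow> x \<in> supp p"
    and lower_P_finite_supp: "x \<in> supp p \<Longrightarrow> lower_P p l (n + 1) x < \<infinity>"
begin

lemma supp_bounds: "x \<in> supp p \<Longrightarrow> l < ereal x" "x \<in> supp p \<Longrightarrow> ereal x < u"
  using supp_subset by (auto simp: einterval_iff)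

lemmas [measurable] = lower_P_measurable[OF p_measurable]

lemma lP_measurable[measurable]: "lP p l j \<in> borel_measurable borel"
  unfolding lP_def by measurable

lemma lP_nonneg: "0 \<le> lP p l j x"
  by (simp add: lP_def)

lemma lP_0: "lP p l 0 = p"
  by (auto simp: lP_def p_nonneg)

lemma lower_P_Suc_mono: "x \<le> y \<Longrightarrow> lower_P p l (Suc j) x \<le> lower_P p l (Suc j) y"
  by (auto intro!: nn_integral_mono mult_left_mono simp: indicator_def einterval_iff intro: less_le_trans)

text \<open>Downward induction on the order. If the next tail is finite at some
  \<open>y > x\<close>, then the present one is finite almost everywhere below \<open>y\<close>,
  hence at some \<open>t\<close> between \<open>x\<close> and \<open>y\<close>, and monotonicity
  carries this down to \<open>x\<close>.\<close>

lemma lower_P_finite: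
  assumes "j \<le> n" "ereal x < u"
  shows "lower_P p l (Suc j) x < \<infinity>"
  using assms
proof (induction arbitrary: x rule: inc_induct)
  case base
  then obtain y where y: "y \<in> supp p" "x < y" using supp_cofinal by blast
  have "lower_P p l (Suc n) x \<le> lower_P p l (Suc n) y" using y by (intro lower_P_Suc_mono) auto
  also have "\<dots> < \<infinity>" using lower_P_finite_supp[OF y(1)] by simp
  finally show ?case .
next
  case (step j)
  obtain y where y: "y \<in> supp p" "x < y" using step.prems supp_cofinal by blast
  show ?case
  proof (cases "l < ereal x")
    case True
    have "lower_P p l (Suc (Suc j)) y < \<infinity>" using step.IH supp_bounds(2)[OF y(1)] by blast
    then have "(\<integral>\<^sup>+t\<in>einterval l (ereal y). lower_P p l (Suc j) t \<partial>lborel) \<noteq> \<infinity>"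
      using lower_P.simps(2)[of p l "Suc j"] by (metis less_irrefl)
    then have "AE t in lborel. lower_P p l (Suc j) t * indicator (einterval l (ereal y)) t \<noteq> \<infinity>"
      by (intro nn_integral_PInf_AE) measurable
    then have "\<exists>t\<in>{x<..<y}. lower_P p l (Suc j) t * indicator (einterval l (ereal y)) t \<noteq> \<infinity>"
      using not_AE_not_in_Ioo[OF y(2)] by (rule_tac ccontr) (erule notE, erule eventually_mono, blast)
    then obtain t where "lower_P p l (Suc j) t * indicator (einterval l (ereal y)) t \<noteq> \<infinity>" "t \<in> {x<..<y}"
      by blast
    then have t: "lower_P p l (Suc j) t < \<infinity>" "x < t"
      using True less_trans[of l "ereal x" "ereal t"] by (auto simp: einterval_iff indicator_def less_top)
    have "lower_P p l (Suc j) x \<le> lower_P p l (Suc j) t" using t by (intro lower_P_Suc_mono) auto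
    then show ?thesis using t(1) by (rule le_less_trans)
  next
    case False
    then have "einterval l (ereal x) = {}"
      unfolding einterval_def using less_trans[of l _ "ereal x"] by blast
    then show ?thesis by simp
  qed
qed

lemma ennreal_lP: "j \<le> n + 1 \<Longrightarrow> ereal x < u \<Longrightarrow> ennreal (lP p l j x) = lower_P p l j x"
  unfolding lP_def using lower_P_finite[of "j - 1" x]
  by (cases j) (auto simp del: lower_P.simps(2) simp: p_nonneg less_top)

text \<open>Finiteness below \<open>u\<close> makes the passage from \<open>ennreal\<close> to
  \<open>real\<close> lossless, which turns the recursion for \<open>lower_P\<close> into one
  between Lebesgue integrals.\<close>

lemma
  assumes "j \<le> n" "ereal x < u"
  shows set_integrable_lP: "set_integrable lborel (einterval l (ereal x)) (lP p l j)"
    and lP_Suc: "lP p l (Suc j) x = (LBINT t:einterval l (ereal x). lP p l j t)"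
proof -
  have "lower_P p l (Suc j) x = (\<integral>\<^sup>+t. ennreal (indicator (einterval l (ereal x)) t *\<^sub>R lP p l j t) \<partial>lborel)"
    unfolding lower_P.simps
  proof (rule nn_integral_cong)
    fix t
    show "lower_P p l j t * indicator (einterval l (ereal x)) t = ennreal (indicator (einterval l (ereal x)) t *\<^sub>R lP p l j t)"
      using ennreal_lP[of j t] assms less_trans[of "ereal t" "ereal x" u]
      by (auto simp: indicator_def einterval_iff)
  qed
  moreover have "lower_P p l (Suc j) x < \<infinity>" using lower_P_finite assms by blast
  ultimately have eq: "(\<integral>\<^sup>+t. ennreal (indicator (einterval l (ereal x)) t *\<^sub>R lP p l j t) \<partial>lborel) = ennreal (lP p l (Suc j) x)"
    using ennreal_lP[of "Suc j" x] assms by simp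
  have "has_bochner_integral lborel (\<lambda>t. indicator (einterval l (ereal x)) t *\<^sub>R lP p l j t) (lP p l (Suc j) x)"
    by (rule has_bochner_integral_nn_integral[OF _ _ _ eq]) (auto simp: lP_nonneg)
  then show "set_integrable lborel (einterval l (ereal x)) (lP p l j)"
    and "lP p l (Suc j) x = (LBINT t:einterval l (ereal x). lP p l j t)"
    by (auto simp: set_integrable_def set_lebesgue_integral_def has_bochner_integral_iff)
qed

lemma has_real_derivative_LBINT_lower:
  assumes "\<And>y. ereal y < u \<Longrightarrow> set_integrable lborel (einterval l (ereal y)) G"
    and "x \<in> supp p" "isCont G x"
  shows "((\<lambda>y. LBINT t:einterval l (ereal y). G t) has_real_derivative G x) (at x)"
proof -
  obtain b where "b \<in> supp p" "x < b" using supp_cofinal supp_bounds assms(2) by blast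
  then show ?thesis
    using assms supp_bounds by (intro has_real_derivative_LBINT_upper_limit[of _ b]) auto
qed

text \<open>Continuity of one tail makes the next one differentiable on the support, which closes
  the induction.\<close>

lemma isCont_lP: "j \<le> n + 1 \<Longrightarrow> x \<in> supp p \<Longrightarrow> isCont (lP p l j) x"
proof (induction j)
  case 0
  then show ?case using p_cont by (simp add: lP_0)
next
  case (Suc j)
  have "((\<lambda>y. LBINT t:einterval l (ereal y). lP p l j t) has_real_derivative lP p l j x) (at x)"
    using Suc by (intro has_real_derivative_LBINT_lower set_integrable_lP) auto
  then have "(lP p l (Suc j) has_real_derivative lP p l j x) (at x)"
    by (rule has_field_derivative_transform_within_open[OF _ open_supp Suc.prems(2)])
      (use Suc.prems supp_bounds lP_Suc in auto)
  then show ?case by (rule DERIV_isCont)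
qed

lemma lP_pos:
  assumes "j \<le> n + 1" "x \<in> supp p"
  shows "0 < lP p l j x"
  using assms
proof (induction j arbitrary: x)
  case 0
  then show ?case by (simp add: lP_0 supp_def)
next
  case (Suc j)
  obtain e where e: "0 < e" "cball x e \<subseteq> supp p" using open_supp Suc.prems open_contains_cball by blast
  have sub: "{x - e<..<x} \<subseteq> supp p"
    using e(2) by (auto simp: cball_eq_atLeastAtMost subset_iff)
  have si: "set_integrable lborel (einterval l (ereal x)) (lP p l j)"
    using Suc.prems supp_bounds by (intro set_integrable_lP) auto
  have "lP p l (Suc j) x \<noteq> 0"
  proof
    assume "lP p l (Suc j) x = 0"
    then have "(LBINT t. indicator (einterval l (ereal x)) t *\<^sub>R lP p l j t) = 0"
      using lP_Suc[of j x] Suc.prems supp_bounds by (auto simp: set_lebesgue_integral_def)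
    then have "AE t in lborel. indicator (einterval l (ereal x)) t *\<^sub>R lP p l j t = 0"
      using si unfolding set_integrable_def
      by (subst (asm) integral_nonneg_eq_0_iff_AE) (auto simp: lP_nonneg)
    then have "AE t in lborel. t \<notin> {x - e<..<x}"
    proof (rule AE_mp, intro AE_I2 impI notI)
      fix t assume *: "indicator (einterval l (ereal x)) t *\<^sub>R lP p l j t = 0" and t: "t \<in> {x - e<..<x}"
      have "t \<in> supp p" using sub t by blast
      then have "0 < lP p l j t" "t \<in> einterval l (ereal x)"
        using Suc supp_bounds t by (auto simp: einterval_iff)
      then show False using * by simp
    qed
    then show False using e(1) not_AE_not_in_Ioo[of "x - e" x] by simp
  qed
  then show ?case using lP_nonneg[of "Suc j" x] by simp
qed

text \<open>\<open>H\<close> is an abstract chain of derivatives because it has two uses: for the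
  derivatives of \<open>h\<close>, and for the signed chain that arises from them by reflection.
  Integrability is supposed at the top order only.\<close>

context
  fixes H :: "nat \<Rightarrow> real \<Rightarrow> real"
  assumes H_deriv: "\<And>j x. j < n \<Longrightarrow> (H j has_real_derivative H (Suc j) x) (at x)"
    and H_cont: "\<And>j. j \<le> n \<Longrightarrow> continuous_on UNIV (H j)"
    and H_integrable: "\<And>x. ereal x < u \<Longrightarrow> set_integrable lborel (einterval l (ereal x)) (\<lambda>t. H n t * lP p l n t)"
begin

text \<open>The integration by parts through Fubini's theorem deduces integrability at order
  \<open>j\<close> from that at order \<open>Suc j\<close>, so it descends from the top order to
  every lower one.\<close>

lemma set_integrable_H_lP:
  assumes "j \<le> n" "ereal x < u"
  shows "set_integrable lborel (einterval l (ereal x)) (\<lambda>t. H j t * lP p l j t)"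
    and "j < n \<Longrightarrow> (LBINT t:einterval l (ereal x). H j t * lP p l j t)
        = H j x * lP p l (Suc j) x - (LBINT t:einterval l (ereal x). H (Suc j) t * lP p l (Suc j) t)"
proof -
  have by_parts: "set_integrable lborel (einterval l (ereal x)) (\<lambda>t. H j t * lP p l j t) \<and>
      (LBINT t:einterval l (ereal x). H j t * lP p l j t)
        = H j x * lP p l (Suc j) x - (LBINT t:einterval l (ereal x). H (Suc j) t * lP p l (Suc j) t)"
    if j: "j < n" and si: "set_integrable lborel (einterval l (ereal x)) (\<lambda>t. H (Suc j) t * lP p l (Suc j) t)" for j
  proof -
    have eq: "lP p l (Suc j) t = (LBINT s:einterval l (ereal t). lP p l j s)" if "t \<le> x" for t
      using that j assms(2) by (intro lP_Suc) (auto intro: ereal_le_less_trans)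
    \<comment> \<open>The integration by parts speaks of the integral of \<open>lP p l j\<close>; it
      agrees with \<open>lP p l (Suc j)\<close> only where the latter is known to be finite, and the
      indicator restricts the comparison to such \<open>t\<close>.\<close>
    have cong: "indicator (einterval l (ereal x)) t *\<^sub>R (H (Suc j) t * lP p l (Suc j) t)
      = indicator (einterval l (ereal x)) t *\<^sub>R (H (Suc j) t * (LBINT s:einterval l (ereal t). lP p l j s))" for t
      using eq[of t] by (auto simp: indicator_def einterval_iff)
    have si': "set_integrable lborel (einterval l (ereal x)) (\<lambda>t. H (Suc j) t * (LBINT s:einterval l (ereal t). lP p l j s))"
      using si unfolding set_integrable_def cong .
    have "(LBINT t:einterval l (ereal x). H (Suc j) t * lP p l (Suc j) t)
      = (LBINT t:einterval l (ereal x). H (Suc j) t * (LBINT s:einterval l (ereal t). lP p l j s))"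
      unfolding set_lebesgue_integral_def cong ..
    moreover have "set_integrable lborel (einterval l (ereal x)) (lP p l j)"
      using j assms(2) by (intro set_integrable_lP) auto
    note LBINT_by_parts_lower[OF lP_measurable lP_nonneg this H_deriv[OF j] H_cont si']
    ultimately show ?thesis using j eq[of x] by simp
  qed
  have si: "set_integrable lborel (einterval l (ereal x)) (\<lambda>t. H j t * lP p l j t)" if "j \<le> n" for j
    using that
  proof (induction rule: inc_induct)
    case base
    then show ?case using H_integrable assms(2) by blast
  next
    case (step k)
    then show ?case using by_parts[of k] by blast
  qed
  show "set_integrable lborel (einterval l (ereal x)) (\<lambda>t. H j t * lP p l j t)" using si assms(1) .
  show "j < n \<Longrightarrow> (LBINT t:einterval l (ereal x). H j t * lP p l j t)
        = H j x * lP p l (Suc j) x - (LBINT t:einterval l (ereal x). H (Suc j) t * lP p l (Suc j) t)"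
    using by_parts[of j] si[of "Suc j"] by simp
qed

lemma has_real_derivative_LBINT_H_lP:
  assumes "j \<le> n" "x \<in> supp p"
  shows "((\<lambda>y. LBINT t:einterval l (ereal y). H j t * lP p l j t) has_real_derivative H j x * lP p l j x) (at x)"
proof (rule has_real_derivative_LBINT_lower)
  show "isCont (\<lambda>t. H j t * lP p l j t) x"
    using assms H_cont[OF assms(1)] isCont_lP[of j x] by (intro isCont_mult) (auto simp: continuous_on_eq_continuous_at)
qed (use assms set_integrable_H_lP in auto)

end

text \<open>The bounds on \<open>g\<close> are known on the support alone; by \<open>AE_supp\<close>
  this is almost all of the interval of integration.\<close>

lemma LBINT_lP_bounds:
  assumes int: "set_integrable lborel (einterval l (ereal x)) (\<lambda>t. g t * lP p l n t)"
    and "ereal x < u" and bounds: "\<And>t. t \<in> supp p \<Longrightarrow> c \<le> g t \<and> g t \<le> C"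
  shows "c * lP p l (Suc n) x \<le> (LBINT t:einterval l (ereal x). g t * lP p l n t)"
    and "(LBINT t:einterval l (ereal x). g t * lP p l n t) \<le> C * lP p l (Suc n) x"
proof -
  have AE: "AE t\<in>einterval l (ereal x) in lborel. t \<in> supp p"
    using AE_supp by (rule AE_mp) (use assms(2) in \<open>auto simp: einterval_iff intro!: AE_I2 intro: ereal_le_less_trans less_imp_le\<close>)
  have si: "set_integrable lborel (einterval l (ereal x)) (\<lambda>t. a * lP p l n t)" for a
    using set_integrable_lP[of n x] assms(2) by simp
  have eq: "a * lP p l (Suc n) x = (LBINT t:einterval l (ereal x). a * lP p l n t)" for a
    using lP_Suc[of n x] assms(2) by simp
  show "c * lP p l (Suc n) x \<le> (LBINT t:einterval l (ereal x). g t * lP p l n t)"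
    unfolding eq using AE
    by (intro set_integral_mono_AE si int) (auto elim!: eventually_mono simp: lP_nonneg bounds intro!: mult_right_mono)
  show "(LBINT t:einterval l (ereal x). g t * lP p l n t) \<le> C * lP p l (Suc n) x"
    unfolding eq using AE
    by (intro set_integral_mono_AE si int) (auto elim!: eventually_mono simp: lP_nonneg bounds intro!: mult_right_mono)
qed

end

section \<open>Derivatives of the Stein solution\<close>

lemma ereal_less_le_trans: "l < ereal x \<Longrightarrow> x \<le> t \<Longrightarrow> l < ereal t"
  by (meson ereal_less_eq(3) less_le_trans)

lemma ereal_uminus_less_uminus_iff: "ereal (- x) < - l \<longleftrightarrow> l < ereal x"
  using ereal_minus_less_minus[of "ereal x" l] by simp

text \<open>The partition of the support into intervals no longer appears: all that the argument
  takes from it is contained in the two instances of \<open>lower_tail\<close>.\<close>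

locale stein_setting = prob_space M
  for M :: "'a measure" +
  fixes Z :: "'a \<Rightarrow> real" and p w h :: "real \<Rightarrow> real" and l u :: ereal and n :: nat
  assumes dist: "distributed M lborel Z (\<lambda>x. ennreal (p x))"
    and lower_tail: "lower_tail p l u n"
    and upper_tail: "lower_tail (\<lambda>t. p (- t)) (- u) (- l) n"
    and w_pos: "x \<in> supp p \<Longrightarrow> 0 < w x"
    and h_integrable: "integrable (density lborel (\<lambda>x. ennreal (p x))) h"
    and M_minus: "r \<ge> 1 \<Longrightarrow> fun_M_defined p w l u r (int r - 1) \<Longrightarrow> x \<in> supp p \<Longrightarrow>
           fun_M p w l u r (int r - 1) x = - 1 / w x"
    and M_diag: "fun_M_defined p w l u r (int r) \<Longrightarrow> x \<in> supp p \<Longrightarrow> fun_M p w l u r (int r) x = 0"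
    and h_differentiable: "times_differentiable_on n UNIV h"
    and hyp_n: "kernel_hyp M Z p w l u n n ((deriv ^^ n) h)"
    and hyp_Suc_n: "kernel_hyp M Z p w l u (n + 1) n ((deriv ^^ n) h)"
begin

sublocale lo: lower_tail p l u n by (rule lower_tail)
sublocale up: lower_tail "\<lambda>t. p (- t)" "- u" "- l" n by (rule upper_tail)

abbreviation "a i \<equiv> (deriv ^^ i) (upper_m p w u)"
abbreviation "b i \<equiv> (deriv ^^ i) (lower_m p w l)"
abbreviation "H j \<equiv> (deriv ^^ j) h"
abbreviation "L j \<equiv> lP p l j"
abbreviation "U j \<equiv> uP p u j"
abbreviation "I j x \<equiv> LBINT t:einterval l (ereal x). H j t * L j t"
abbreviation "J j x \<equiv> LBINT t:einterval (ereal x) u. H j t * U j t"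

lemma Z_measurable[measurable]: "Z \<in> measurable M borel"
  using distributed_measurable[OF dist] by simp

lemma U_reflect: "U j x = lP (\<lambda>t. p (- t)) (- u) j (- x)"
  by (rule uP_reflect) measurable

lemma U_measurable[measurable]: "U j \<in> borel_measurable borel"
  unfolding U_reflect by measurable

lemma supp_reflect: "x \<in> supp p \<longleftrightarrow> - x \<in> supp (\<lambda>t. p (- t))"
  by (simp add: supp_def)

lemma U_nonneg: "0 \<le> U j x"
  by (simp add: uP_def)

lemma U_pos: "j \<le> n + 1 \<Longrightarrow> x \<in> supp p \<Longrightarrow> 0 < U j x"
  unfolding U_reflect supp_reflect by (rule up.lP_pos)

lemma upper_P_finite: "j \<le> n \<Longrightarrow> l < ereal x \<Longrightarrow> upper_P p u (Suc j) x < \<infinity>"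
  using up.lower_P_finite[of j "- x"]
  by (simp add: ereal_uminus_less_uminus_iff upper_P_reflect del: lower_P.simps upper_P.simps)

lemma
  assumes "j \<le> n" "l < ereal x"
  shows set_integrable_U: "set_integrable lborel (einterval (ereal x) u) (U j)"
    and U_Suc: "U (Suc j) x = (LBINT t:einterval (ereal x) u. U j t)"
  using up.set_integrable_lP[of j "- x"] up.lP_Suc[of j "- x"] assms
    set_integral_reflect_einterval[of u x "U j"] unfolding U_reflect by (simp_all add: ereal_uminus_less_uminus_iff)

lemma p_integrable: "integrable lborel p"
  using distributed_integrable[OF dist, of "\<lambda>_. 1"] lo.p_nonneg by simp

lemma p_integral: "(LBINT t. p t) = 1"
  using distributed_integral[OF dist, of "\<lambda>_. 1"] lo.p_nonneg prob_space by simp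

lemma integral_split:
  fixes f :: "real \<Rightarrow> real"
  assumes f: "integrable lborel f" "\<And>t. t \<notin> supp p \<Longrightarrow> f t = 0" and x: "x \<in> supp p"
  shows "(LBINT t. f t) = (LBINT t:einterval l (ereal x). f t) + (LBINT t:einterval (ereal x) u. f t)"
proof -
  have si: "set_integrable lborel A f" if "A \<in> sets borel" for A
    using f(1) that unfolding set_integrable_def by (intro integrable_mult_indicator) auto
  have "(LBINT t. f t) = (LBINT t:einterval l (ereal x) \<union> einterval (ereal x) u. f t)"
    unfolding set_lebesgue_integral_def
  proof (rule integral_cong_AE)
    show "AE t in lborel. f t = indicator (einterval l (ereal x) \<union> einterval (ereal x) u) t *\<^sub>R f t"
      using AE_lborel_singleton[of x]
    proof (rule AE_mp, intro AE_I2 impI)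
      fix t assume "t \<noteq> x"
      then show "f t = indicator (einterval l (ereal x) \<union> einterval (ereal x) u) t *\<^sub>R f t"
        using f(2)[of t] lo.supp_bounds[of t] by (cases "t \<in> supp p") (auto simp: indicator_def einterval_iff)
    qed
  qed (use f(1) in auto)
  also have "\<dots> = (LBINT t:einterval l (ereal x). f t) + (LBINT t:einterval (ereal x) u. f t)"
    by (intro set_integral_Un si) (auto simp: einterval_iff)
  finally show ?thesis .
qed

lemma L_U_total: "x \<in> supp p \<Longrightarrow> L 1 x + U 1 x = 1"
  using integral_split[OF p_integrable, of x] lo.lP_Suc[of 0 x] U_Suc[of 0 x] lo.supp_bounds[of x] p_integral
    lo.p_nonneg by (simp add: supp_def lo.lP_0 uP_def[abs_def] order_antisym_conv not_less)

section \<open>The kernel identities, and integrability of the top derivative against the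
  tails\<close>

lemma a_b_field_differentiable:
  assumes "i \<le> n + 1" "x \<in> supp p"
  shows "a i field_differentiable at x" "b i field_differentiable at x"
proof -
  obtain \<delta> where "0 < \<delta>" "times_differentiable_on (n + 2) {x - \<delta><..<x + \<delta>} (a 0)"
    using hyp_Suc_n assms(2) unfolding kernel_hyp_def derivs_abs_cont_near_def by auto
  then show "a i field_differentiable at x" using assms(1) unfolding times_differentiable_on_def by auto
  obtain \<delta> where "0 < \<delta>" "times_differentiable_on (n + 2) {x - \<delta><..<x + \<delta>} (b 0)"
    using hyp_Suc_n assms(2) unfolding kernel_hyp_def derivs_abs_cont_near_def by auto
  then show "b i field_differentiable at x" using assms(1) unfolding times_differentiable_on_def by auto
qed

lemma a_b_deriv:
  assumes "i \<le> n + 1" "x \<in> supp p"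
  shows "(a i has_real_derivative a (Suc i) x) (at x)" "(b i has_real_derivative b (Suc i) x) (at x)"
  using a_b_field_differentiable[OF assms] by (simp_all add: DERIV_deriv_iff_field_differentiable)

lemma fun_M_definedI: "r \<le> n + 1 \<Longrightarrow> nat (j + 1) \<le> n + 1 \<Longrightarrow> fun_M_defined p w l u r j"
  unfolding fun_M_defined_def times_differentiable_on_def
  using a_b_field_differentiable lo.lower_P_finite[of "nat (j + 1) - 1"] upper_P_finite[of "nat (j + 1) - 1"] lo.supp_bounds
  by (cases "nat (j + 1)") (auto simp del: lower_P.simps(2) upper_P.simps(2) simp: less_Suc_eq_le)

text \<open>For \<open>r \<ge> 1\<close> this is the hypothesis on \<open>fun_M\<close> with signs
  rearranged. The case \<open>r = 0\<close> expresses that the total mass is one, and it starts the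
  chain of derivatives.\<close>

lemma M_minus_eq:
  assumes "r \<le> n + 1" "x \<in> supp p"
  shows "(-1) ^ r * a r x * L r x + b r x * U r x = 1 / w x"
proof (cases r)
  case 0
  have "0 < p x" using assms by (simp add: supp_def)
  then have "a 0 x * p x + b 0 x * p x = (L 1 x + U 1 x) / w x"
    using w_pos[OF assms(2)] by (simp add: upper_m_def lower_m_def field_simps)
  then show ?thesis using 0 L_U_total[OF assms(2)] by (simp add: lo.lP_0 uP_def[of _ _ 0] lo.p_nonneg)
next
  case (Suc k)
  have "fun_M p w l u r (int r - 1) x = - 1 / w x"
    using assms Suc by (intro M_minus fun_M_definedI) auto
  moreover have "nat (int k + 1) = Suc k" by simp
  ultimately show ?thesis using Suc by (simp add: fun_M_def algebra_simps)
qed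

lemma M_diag_eq:
  assumes "r \<le> n" "x \<in> supp p"
  shows "(-1) ^ r * a r x * L (Suc r) x - b r x * U (Suc r) x = 0"
proof -
  have "fun_M p w l u r (int r) x = 0" using assms by (intro M_diag fun_M_definedI) auto
  moreover have "nat (int r + 1) = Suc r" by simp
  ultimately show ?thesis by (simp add: fun_M_def)
qed

text \<open>The two identities on \<open>M\<close> force the signs, so the factor of the kernel does not vanish and
  the integrability of the kernel yields that of \<open>h^(n)\<close> against the iterated tails.\<close>

lemma a_b_pos:
  assumes "x \<in> supp p"
  shows "0 < (-1) ^ n * a n x" "0 < b n x"
proof -
  define A where "A = (-1) ^ n * a n x"
  let ?A = A
  have sum: "0 < ?A * L n x + b n x * U n x"
    using M_minus_eq[of n x] w_pos assms by (simp add: A_def)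
  have eq: "?A * L (Suc n) x = b n x * U (Suc n) x" using M_diag_eq[of n x] assms by (simp add: A_def)
  have pos: "0 < L n x" "0 < U n x" "0 < L (Suc n) x" "0 < U (Suc n) x"
    using lo.lP_pos U_pos assms by auto
  have A: "0 < ?A"
  proof (rule ccontr)
    assume "\<not> 0 < ?A"
    then have "b n x * U (Suc n) x \<le> 0" using eq pos by (metis mult_nonpos_nonneg not_less less_imp_le)
    then have "b n x \<le> 0" using pos by (simp add: mult_le_0_iff)
    then have "?A * L n x + b n x * U n x \<le> 0"
      using \<open>\<not> 0 < ?A\<close> pos by (intro add_nonpos_nonpos mult_nonpos_nonneg) auto
    then show False using sum by simp
  qed
  then show "0 < (-1) ^ n * a n x" by (simp add: A_def)
  have "0 < b n x * U (Suc n) x" using eq A pos by (metis mult_pos_pos)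
  then show "0 < b n x" using pos by (simp add: zero_less_mult_iff)
qed

lemma H_deriv: "j < n \<Longrightarrow> (H j has_real_derivative H (Suc j) x) (at x)"
  using h_differentiable unfolding times_differentiable_on_def
  by (simp add: DERIV_deriv_iff_field_differentiable)

lemma supp_nonempty: "\<exists>x. x \<in> supp p"
proof -
  have "\<not> (\<forall>t. p t = 0)"
  proof
    assume "\<forall>t. p t = 0"
    then have "(LBINT t. p t) = 0" by simp
    then show False using p_integral by simp
  qed
  then show ?thesis using lo.p_nonneg unfolding supp_def by (auto simp: order.strict_iff_order)
qed

lemma H_cont: "j \<le> n \<Longrightarrow> continuous_on UNIV (H j)"
proof (cases "j = n")
  case True
  obtain x where "x \<in> supp p" using supp_nonempty by blast
  then have "locally_abs_cont_on UNIV (H n)" using hyp_n unfolding kernel_hyp_def by blast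
  then show ?thesis
    using locally_abs_cont_on_imp_isCont[of UNIV "H n"] True by (auto simp: continuous_on_eq_continuous_at)
next
  case False
  moreover assume "j \<le> n"
  ultimately show ?thesis using H_deriv[of j] by (auto simp: continuous_on_eq_continuous_at intro: DERIV_isCont)
qed

lemma H_measurable[measurable (raw)]: "j \<le> n \<Longrightarrow> H j \<in> borel_measurable borel"
  using H_cont by (intro borel_measurable_continuous_onI)

lemma kernel_K_measurable[measurable]: "kernel_K p w l u i n x \<in> borel_measurable borel"
  unfolding kernel_K_def[abs_def] by measurable

lemma p_kernel_K:
  "v \<in> supp p \<Longrightarrow> p v * kernel_K p w l u i n x v
    = (-1) ^ n * a i x * L n v * indicator {..x} v - b i x * U n v * indicator {x<..} v"
  unfolding kernel_K_def by (auto simp: supp_def indicator_def)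

text \<open>The density of \<open>Z\<close> cancels the factor \<open>1 / p v\<close> of the kernel.
  On either side of \<open>x\<close> there remains a constant times an iterated tail, and
  \<open>a_b_pos\<close> permits division by that constant.\<close>

lemma H_L_U_integrable_supp:
  assumes x: "x \<in> supp p"
  shows "set_integrable lborel (einterval l (ereal x)) (\<lambda>t. H n t * L n t)"
    and "set_integrable lborel (einterval (ereal x) u) (\<lambda>t. H n t * U n t)"
proof -
  have [measurable]: "H n \<in> borel_measurable borel" by measurable
  have "integrable M (\<lambda>s. \<bar>kernel_K p w l u n n x (Z s) * H n (Z s)\<bar>
                      + \<bar>kernel_K p w l u n (n + 1) x (Z s) * deriv (H n) (Z s)\<bar>
                      + \<bar>kernel_K p w l u (n + 1) n x (Z s) * H n (Z s)\<bar>)"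
    using hyp_n x unfolding kernel_hyp_def by blast
  then have "integrable M (\<lambda>s. kernel_K p w l u n n x (Z s) * H n (Z s))"
    by (rule Bochner_Integration.integrable_bound) auto
  then have int: "integrable lborel (\<lambda>v. p v * (kernel_K p w l u n n x v * H n v))"
    using lo.p_nonneg by (subst distributed_integrable[OF dist, of "\<lambda>v. kernel_K p w l u n n x v * H n v"]) auto
  have si: "set_integrable lborel A (\<lambda>v. p v * (kernel_K p w l u n n x v * H n v))" if "A \<in> sets borel" for A
    using int that unfolding set_integrable_def by (intro integrable_mult_indicator) auto
  have AE: "AE v\<in>A in lborel. v \<in> supp p" if "A \<subseteq> einterval l u" for A
    using lo.AE_supp by (rule AE_mp) (use that in \<open>auto intro!: AE_I2\<close>)
  have "set_integrable lborel (einterval l (ereal x)) (\<lambda>v. ((-1) ^ n * a n x) * (H n v * L n v))"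
    using si[of "einterval l (ereal x)"]
  proof (rule set_integrable_cong_AE[THEN iffD1, rotated -1])
    have sub: "einterval l (ereal x) \<subseteq> einterval l u"
      using lo.supp_bounds(2)[OF x] ereal_le_less_trans[of _ x u] by (auto simp: einterval_iff)
    show "AE v\<in>einterval l (ereal x) in lborel. p v * (kernel_K p w l u n n x v * H n v) = ((-1) ^ n * a n x) * (H n v * L n v)"
      using AE[OF sub]
    proof (rule AE_mp, intro AE_I2 impI)
      fix v assume "v \<in> einterval l (ereal x) \<longrightarrow> v \<in> supp p" "v \<in> einterval l (ereal x)"
      then show "p v * (kernel_K p w l u n n x v * H n v) = ((-1) ^ n * a n x) * (H n v * L n v)"
        using p_kernel_K[of v n x] by (simp add: einterval_iff mult.assoc[symmetric], (simp add: mult_ac)?)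
    qed
  qed auto
  then show "set_integrable lborel (einterval l (ereal x)) (\<lambda>t. H n t * L n t)"
    using a_b_pos(1)[OF x] by (subst (asm) set_integrable_mult_right_iff) auto
  have "set_integrable lborel (einterval (ereal x) u) (\<lambda>v. (- b n x) * (H n v * U n v))"
    using si[of "einterval (ereal x) u"]
  proof (rule set_integrable_cong_AE[THEN iffD1, rotated -1])
    have sub: "einterval (ereal x) u \<subseteq> einterval l u"
      using lo.supp_bounds(1)[OF x] ereal_less_le_trans[of l x] by (auto simp: einterval_iff)
    show "AE v\<in>einterval (ereal x) u in lborel. p v * (kernel_K p w l u n n x v * H n v) = (- b n x) * (H n v * U n v)"
      using AE[OF sub]
    proof (rule AE_mp, intro AE_I2 impI)
      fix v assume "v \<in> einterval (ereal x) u \<longrightarrow> v \<in> supp p" "v \<in> einterval (ereal x) u"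
      then show "p v * (kernel_K p w l u n n x v * H n v) = (- b n x) * (H n v * U n v)"
        using p_kernel_K[of v n x] by (simp add: einterval_iff mult.assoc[symmetric], (simp add: mult_ac)?)
    qed
  qed auto
  then show "set_integrable lborel (einterval (ereal x) u) (\<lambda>t. H n t * U n t)"
    using a_b_pos(2)[OF x] by (subst (asm) set_integrable_mult_right_iff) auto
qed

lemma H_L_integrable_n:
  assumes "ereal x < u"
  shows "set_integrable lborel (einterval l (ereal x)) (\<lambda>t. H n t * L n t)"
proof -
  obtain y where y: "y \<in> supp p" "x < y" using lo.supp_cofinal assms by blast
  show ?thesis
    by (rule set_integrable_subset[OF H_L_U_integrable_supp(1)[OF y(1)]])
      (use y in \<open>auto simp: einterval_iff intro: ereal_le_less_trans ereal_less_le_trans less_imp_le\<close>)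
qed

lemma H_U_integrable_n:
  assumes "l < ereal x"
  shows "set_integrable lborel (einterval (ereal x) u) (\<lambda>t. H n t * U n t)"
proof -
  have "ereal (- x) < - l" using assms by (simp add: ereal_uminus_less_uminus_iff)
  then obtain y where y: "y \<in> supp (\<lambda>t. p (- t))" "- x < y" using up.supp_cofinal by blast
  then have y': "- y \<in> supp p" "- y < x" by (auto simp: supp_def)
  show ?thesis
    by (rule set_integrable_subset[OF H_L_U_integrable_supp(2)[OF y'(1)]])
      (use y' in \<open>auto simp: einterval_iff intro: ereal_le_less_trans ereal_less_le_trans less_imp_le\<close>)
qed

section \<open>Integrals of the derivatives of \<open>h\<close> against the tails, and the Stein
  solution\<close>

lemmas I_by_parts = lo.set_integrable_H_lP(2)[OF H_deriv H_cont H_L_integrable_n]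
lemmas I_deriv = lo.has_real_derivative_LBINT_H_lP[OF H_deriv H_cont H_L_integrable_n]

text \<open>The sign turns these functions into the successive derivatives of the reflection of
  \<open>h\<close>, so that they form a chain to which the results on lower tails apply.\<close>

definition "G j t = (-1) ^ j * H j (- t)"

lemma G_deriv: "j < n \<Longrightarrow> (G j has_real_derivative G (Suc j) t) (at t)"
  unfolding G_def[abs_def] by (auto intro!: derivative_eq_intros DERIV_chain2[OF H_deriv] simp: mult_ac)

lemma G_cont: "j \<le> n \<Longrightarrow> continuous_on UNIV (G j)"
  unfolding G_def[abs_def] by (auto intro!: continuous_intros continuous_on_compose2[OF H_cont])

lemma G_U_reflect: "G j t * lP (\<lambda>t. p (- t)) (- u) j t = (\<lambda>t. (-1) ^ j * (H j t * U j t)) (- t)"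
  by (simp add: U_reflect G_def)

lemma G_integrable_n:
  assumes "ereal x < - l"
  shows "set_integrable lborel (einterval (- u) (ereal x)) (\<lambda>t. G n t * lP (\<lambda>t. p (- t)) (- u) n t)"
proof -
  have "l < ereal (- x)" using assms ereal_less_uminus_reorder[of "ereal x" l] by simp
  then show ?thesis
    unfolding G_U_reflect
    using set_integral_reflect_einterval(1)[of u "- x" "\<lambda>t. (-1) ^ n * (H n t * U n t)"] H_U_integrable_n[of "- x"] by simp
qed

lemma LBINT_G: "(LBINT t:einterval (- u) (ereal (- x)). G j t * lP (\<lambda>t. p (- t)) (- u) j t) = (-1) ^ j * J j x"
  using set_integral_reflect_einterval(2)[of u x "\<lambda>t. (-1) ^ j * (H j t * U j t)"]
  unfolding G_U_reflect by simp

lemma J_by_parts: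
  assumes "j < n" "l < ereal x"
  shows "J j x = H j x * U (Suc j) x + J (Suc j) x"
proof -
  have "(-1) ^ j * J j x = (-1) ^ j * (H j x * U (Suc j) x + J (Suc j) x)"
    using up.set_integrable_H_lP(2)[OF G_deriv G_cont G_integrable_n, of j "- x"] assms
    unfolding LBINT_G by (simp add: G_def U_reflect ereal_uminus_less_uminus_iff algebra_simps)
  then show ?thesis by simp
qed

lemma J_deriv:
  assumes "j \<le> n" "x \<in> supp p"
  shows "(J j has_real_derivative - (H j x * U j x)) (at x)"
proof -
  have "((\<lambda>y. LBINT t:einterval (- u) (ereal y). G j t * lP (\<lambda>t. p (- t)) (- u) j t) has_real_derivative
      G j (- x) * lP (\<lambda>t. p (- t)) (- u) j (- x)) (at (- x))"
    using assms supp_reflect by (intro up.has_real_derivative_LBINT_H_lP[OF G_deriv G_cont G_integrable_n]) auto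
  then have "((\<lambda>y. (-1) ^ j * (LBINT t:einterval (- u) (ereal (- y)). G j t * lP (\<lambda>t. p (- t)) (- u) j t)) has_real_derivative
      (-1) ^ j * (G j (- x) * lP (\<lambda>t. p (- t)) (- u) j (- x) * - 1)) (at x)"
    by (intro DERIV_cmult DERIV_chain2[where g = uminus]) (auto intro!: derivative_eq_intros)
  then show ?thesis
    unfolding LBINT_G by (simp add: G_def U_reflect mult.assoc[symmetric] power_mult_distrib[symmetric])
qed

definition "F j x = (-1) ^ j * a j x * I j x - b j x * J j x"

text \<open>The terms in which the integrals are differentiated combine to
  \<open>H j x / w x\<close> by \<open>M_minus_eq\<close>. The formula includes the order
  \<open>n\<close>, where no further integration by parts is available and this form is the final
  one.\<close>

lemma F_deriv:
  assumes "j \<le> n" "x \<in> supp p"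
  shows "(F j has_real_derivative (-1) ^ j * a (Suc j) x * I j x - b (Suc j) x * J j x + H j x / w x) (at x)"
proof -
  have "(F j has_real_derivative
      (((-1) ^ j * a (Suc j) x) * I j x + (H j x * L j x) * ((-1) ^ j * a j x))
      - (b (Suc j) x * J j x + - (H j x * U j x) * b j x)) (at x)"
    unfolding F_def[abs_def] using assms
    by (intro DERIV_diff DERIV_mult DERIV_cmult a_b_deriv I_deriv J_deriv) auto
  moreover have "H j x / w x = H j x * ((-1) ^ j * a j x * L j x + b j x * U j x)"
    using M_minus_eq[of j x] assms by simp
  ultimately show ?thesis by (simp add: algebra_simps)
qed

lemma F_Suc:
  assumes "j < n" "x \<in> supp p"
  shows "(F j has_real_derivative F (Suc j) x) (at x)"
proof -
  have I: "I j x = H j x * L (Suc j) x - I (Suc j) x" and J: "J j x = H j x * U (Suc j) x + J (Suc j) x"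
    using assms lo.supp_bounds[of x] I_by_parts[of j x] J_by_parts[of j x] by auto
  \<comment> \<open>Writing \<open>1 / w x\<close> by the identity of order \<open>Suc j\<close>,
    and not \<open>j\<close>, makes this term the exact negative of the boundary terms produced by
    the two integrations by parts.\<close>
  have w: "H j x / w x = H j x * ((-1) ^ Suc j * a (Suc j) x * L (Suc j) x + b (Suc j) x * U (Suc j) x)"
    using M_minus_eq[of "Suc j" x] assms by simp
  have "(-1) ^ j * a (Suc j) x * I j x - b (Suc j) x * J j x + H j x / w x = F (Suc j) x"
    unfolding I J w F_def by (simp add: algebra_simps)
  then show ?thesis using F_deriv[of j x] assms by simp
qed

abbreviation "f \<equiv> stein_f M Z p w l h"

lemma h_measurable[measurable]: "h \<in> borel_measurable borel"
  using borel_measurable_integrable[OF h_integrable] by simp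

text \<open>The mean of \<open>h\<close> under \<open>Z\<close> is \<open>I 0 x + J 0 x\<close>.
  Since \<open>L 1 x + U 1 x = 1\<close>, subtracting \<open>L 1 x\<close> times the mean from
  \<open>I 0 x\<close> leaves \<open>U 1 x * I 0 x - L 1 x * J 0 x\<close>.\<close>

lemma f_eq_F_0:
  assumes x: "x \<in> supp p"
  shows "f x = F 0 x"
proof -
  let ?E = "\<integral>s. h (Z s) \<partial>M"
  have hp: "integrable lborel (\<lambda>t. h t * p t)"
    using h_integrable lo.p_nonneg by (subst (asm) integrable_real_density) (auto simp: mult.commute)
  have U0: "U 0 = p" using lo.p_nonneg by (auto simp: uP_def)
  have "?E = (LBINT t. h t * p t)"
    using distributed_integral[OF dist, of h] lo.p_nonneg by (simp add: mult.commute)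
  also have "\<dots> = I 0 x + J 0 x"
    using integral_split[OF hp _ x] lo.p_nonneg by (simp add: lo.lP_0 U0 supp_def order_antisym_conv not_less)
  finally have E: "?E = I 0 x + J 0 x" .
  have si: "set_integrable lborel (einterval l (ereal x)) (\<lambda>t. h t * p t)"
    "set_integrable lborel (einterval l (ereal x)) (\<lambda>t. ?E * p t)"
    using hp p_integrable unfolding set_integrable_def by (intro integrable_mult_indicator; simp)+
  have "(LBINT t=l..ereal x. (h t - ?E) * p t) = (LBINT t:einterval l (ereal x). h t * p t - ?E * p t)"
    using lo.supp_bounds[OF x] by (simp add: interval_lebesgue_integral_def less_imp_le left_diff_distrib)
  also have "\<dots> = I 0 x - ?E * L 1 x"
    using set_integral_diff(2)[OF si] lo.lP_Suc[of 0 x] lo.supp_bounds[OF x] by (simp add: lo.lP_0)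
  also have "\<dots> = U 1 x * I 0 x - L 1 x * J 0 x"
  proof -
    have "U 1 x = 1 - L 1 x" using L_U_total[OF x] by simp
    then show ?thesis unfolding E by (simp only:) (simp add: algebra_simps)
  qed
  finally show ?thesis
    unfolding stein_f_def F_def by (simp add: upper_m_def lower_m_def diff_divide_distrib)
qed

text \<open>The two functions agree on the support only, but the support is open, so the equality
  passes to derivatives.\<close>

lemma deriv_f_eq_F: "j \<le> n \<Longrightarrow> x \<in> supp p \<Longrightarrow> (deriv ^^ j) f x = F j x"
proof (induction j arbitrary: x)
  case 0
  then show ?case using f_eq_F_0 by simp
next
  case (Suc j)
  have "(F j has_real_derivative F (Suc j) x) (at x)" using Suc.prems by (intro F_Suc) auto
  then have "((deriv ^^ j) f has_real_derivative F (Suc j) x) (at x)"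
    by (rule has_field_derivative_transform_within_open[OF _ lo.open_supp Suc.prems(2)])
      (use Suc in auto)
  then show ?case by (simp add: DERIV_imp_deriv)
qed

lemma deriv_f_deriv:
  assumes "j \<le> n" "x \<in> supp p"
  shows "((deriv ^^ j) f has_real_derivative (-1) ^ j * a (Suc j) x * I j x - b (Suc j) x * J j x + H j x / w x) (at x)"
  by (rule has_field_derivative_transform_within_open[OF F_deriv[OF assms] lo.open_supp assms(2)])
    (use assms in \<open>auto simp: deriv_f_eq_F\<close>)

lemma times_differentiable_f: "times_differentiable_on n (supp p) f"
  unfolding times_differentiable_on_def field_differentiable_def
  using deriv_f_deriv by (meson less_imp_le)

text \<open>Used with \<open>i = n\<close> and \<open>i = n + 1\<close>, and with two choices of
  \<open>\<phi>\<close>: the top derivative of \<open>h\<close> for the formula of the theorem, and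
  the constant 1 for the total mass of the kernel.\<close>

lemma kernel_K_expectation:
  assumes x: "x \<in> supp p" and [measurable]: "\<phi> \<in> borel_measurable borel"
    and si: "set_integrable lborel (einterval l (ereal x)) (\<lambda>t. \<phi> t * L n t)"
      "set_integrable lborel (einterval (ereal x) u) (\<lambda>t. \<phi> t * U n t)"
  shows "integrable M (\<lambda>s. kernel_K p w l u i n x (Z s) * \<phi> (Z s))"
    and "(\<integral>s. kernel_K p w l u i n x (Z s) * \<phi> (Z s) \<partial>M)
      = (-1) ^ n * a i x * (LBINT t:einterval l (ereal x). \<phi> t * L n t) - b i x * (LBINT t:einterval (ereal x) u. \<phi> t * U n t)"
proof -
  let ?R = "\<lambda>v. (-1) ^ n * a i x * (indicator (einterval l (ereal x)) v *\<^sub>R (\<phi> v * L n v))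
      - b i x * (indicator (einterval (ereal x) u) v *\<^sub>R (\<phi> v * U n v))"
  have AE: "AE v in lborel. p v * (kernel_K p w l u i n x v * \<phi> v) = ?R v"
    using lo.AE_supp AE_lborel_singleton[of x]
  proof eventually_elim
    fix v assume v: "v \<in> einterval l u \<longrightarrow> v \<in> supp p" "v \<noteq> x"
    show "p v * (kernel_K p w l u i n x v * \<phi> v) = ?R v"
    proof (cases "v \<in> supp p")
      case True
      have "p v * (kernel_K p w l u i n x v * \<phi> v) = (p v * kernel_K p w l u i n x v) * \<phi> v" by simp
      also have "\<dots> = ?R v"
      proof -
        have "indicator {..x} v = (indicator (einterval l (ereal x)) v :: real)"
          "indicator {x<..} v = (indicator (einterval (ereal x) u) v :: real)"
          using v(2) lo.supp_bounds[OF True] by (auto simp: indicator_def einterval_iff)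
        then show ?thesis unfolding p_kernel_K[OF True] by (simp add: left_diff_distrib)
      qed
      finally show ?thesis .
    next
      case False
      then have "p v = 0" using lo.p_nonneg[of v] by (simp add: supp_def order_antisym_conv not_less)
      \<comment> \<open>Up to the null set already discarded, a point where \<open>p\<close>
        vanishes lies outside \<open>(l, u)\<close>, so both sides are zero; division by
        \<open>p v = 0\<close> does no harm because of the factor \<open>p v\<close> in
        front.\<close>
      moreover have "v \<notin> einterval l (ereal x)" "v \<notin> einterval (ereal x) u"
        using False v(1) lo.supp_bounds[OF x] by (auto simp: einterval_iff intro: ereal_le_less_trans ereal_less_le_trans less_imp_le)
      ultimately show ?thesis by simp
    qed
  qed
  have intR: "integrable lborel ?R"
    using si unfolding set_integrable_def by (intro Bochner_Integration.integrable_diff integrable_mult_right) auto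
  have "integrable lborel (\<lambda>v. p v * (kernel_K p w l u i n x v * \<phi> v))"
    using intR AE by (subst integrable_cong_AE) auto
  then show "integrable M (\<lambda>s. kernel_K p w l u i n x (Z s) * \<phi> (Z s))"
    using lo.p_nonneg by (subst (asm) distributed_integrable[OF dist]) auto
  have "(\<integral>s. kernel_K p w l u i n x (Z s) * \<phi> (Z s) \<partial>M) = (LBINT v. p v * (kernel_K p w l u i n x v * \<phi> v))"
    using lo.p_nonneg by (subst distributed_integral[OF dist, of "\<lambda>v. kernel_K p w l u i n x v * \<phi> v"]) auto
  also have "\<dots> = (LBINT v. ?R v)" using AE by (intro integral_cong_AE) auto
  also have "\<dots> = (-1) ^ n * a i x * (LBINT t:einterval l (ereal x). \<phi> t * L n t) - b i x * (LBINT t:einterval (ereal x) u. \<phi> t * U n t)"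
    using si unfolding set_integrable_def set_lebesgue_integral_def
    by (subst Bochner_Integration.integral_diff) (auto intro!: integrable_mult_right)
  finally show "(\<integral>s. kernel_K p w l u i n x (Z s) * \<phi> (Z s) \<partial>M)
      = (-1) ^ n * a i x * (LBINT t:einterval l (ereal x). \<phi> t * L n t) - b i x * (LBINT t:einterval (ereal x) u. \<phi> t * U n t)" .
qed

lemma LBINT_U_bounds:
  assumes int: "set_integrable lborel (einterval (ereal x) u) (\<lambda>t. g t * U n t)"
    and x: "l < ereal x" and bounds: "\<And>t. t \<in> supp p \<Longrightarrow> c \<le> g t \<and> g t \<le> C"
  shows "c * U (Suc n) x \<le> (LBINT t:einterval (ereal x) u. g t * U n t)"
    and "(LBINT t:einterval (ereal x) u. g t * U n t) \<le> C * U (Suc n) x"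
  using up.LBINT_lP_bounds[of "- x" "\<lambda>t. g (- t)" c C] int x bounds
    set_integral_reflect_einterval[of u x "\<lambda>t. g t * U n t"]
  unfolding U_reflect by (simp_all add: supp_def ereal_uminus_less_uminus_iff)

end

section \<open>The weighted derivative at a point where the weight is differentiable\<close>

context stein_setting
begin

context
  fixes \<omega> :: "real \<Rightarrow> real" and x :: real
  assumes x: "x \<in> supp p" and \<omega>: "\<omega> field_differentiable at x"
begin

abbreviation "A \<equiv> deriv \<omega> x * a n x + \<omega> x * a (n + 1) x"
abbreviation "B \<equiv> deriv \<omega> x * b n x + \<omega> x * b (n + 1) x"

lemma \<omega>_deriv: "(\<omega> has_real_derivative deriv \<omega> x) (at x)"
  using \<omega> by (simp add: DERIV_deriv_iff_field_differentiable)

lemma deriv_\<omega>_a: "deriv (\<lambda>y. \<omega> y * a n y) x = A"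
  by (rule DERIV_imp_deriv, rule DERIV_cong[OF DERIV_mult[OF \<omega>_deriv a_b_deriv(1)[of n]]])
    (use x in auto)

lemma deriv_\<omega>_b: "deriv (\<lambda>y. \<omega> y * b n y) x = B"
  by (rule DERIV_imp_deriv, rule DERIV_cong[OF DERIV_mult[OF \<omega>_deriv a_b_deriv(2)[of n]]])
    (use x in auto)

lemma fun_V_eq: "fun_V p w l u \<omega> n x = \<bar>A\<bar> * L (n + 1) x + \<bar>B\<bar> * U (n + 1) x"
  unfolding fun_V_def deriv_\<omega>_a deriv_\<omega>_b ..

text \<open>The part with the derivative of \<open>\<omega>\<close> vanishes by the diagonal
  identity of order \<open>n\<close>; the part with \<open>\<omega>\<close> itself is the identity
  of order \<open>n + 1\<close>. This one equation yields the mean of \<open>kernel_Lambda\<close>,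
  the value of \<open>fun_V\<close>, and the oscillation bound.\<close>

lemma A_B_balance: "(-1) ^ n * A * L (n + 1) x - B * U (n + 1) x = - (\<omega> x / w x)"
proof -
  have 1: "(-1) ^ n * a n x * L (n + 1) x - b n x * U (n + 1) x = 0"
    using M_diag_eq[of n x] x by simp
  have 2: "(-1) ^ n * a (n + 1) x * L (n + 1) x - b (n + 1) x * U (n + 1) x = - (1 / w x)"
    using M_minus_eq[of "n + 1" x] x by simp
  have "(-1) ^ n * A * L (n + 1) x - B * U (n + 1) x
      = deriv \<omega> x * ((-1) ^ n * a n x * L (n + 1) x - b n x * U (n + 1) x)
        + \<omega> x * ((-1) ^ n * a (n + 1) x * L (n + 1) x - b (n + 1) x * U (n + 1) x)"
    by (simp add: algebra_simps)
  then show ?thesis unfolding 1 2 by simp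
qed

lemma kernel_Lambda_expectation:
  assumes \<phi>: "\<phi> \<in> borel_measurable borel"
    and si: "set_integrable lborel (einterval l (ereal x)) (\<lambda>t. \<phi> t * L n t)"
      "set_integrable lborel (einterval (ereal x) u) (\<lambda>t. \<phi> t * U n t)"
  shows "integrable M (\<lambda>s. kernel_Lambda p w l u \<omega> n x (Z s) * \<phi> (Z s))"
    and "(\<integral>s. kernel_Lambda p w l u \<omega> n x (Z s) * \<phi> (Z s) \<partial>M)
      = (-1) ^ n * A * (LBINT t:einterval l (ereal x). \<phi> t * L n t) - B * (LBINT t:einterval (ereal x) u. \<phi> t * U n t)"
proof -
  note K = kernel_K_expectation[OF x \<phi> si]
  have eq: "kernel_Lambda p w l u \<omega> n x v * \<phi> v
      = deriv \<omega> x * (kernel_K p w l u n n x v * \<phi> v) + \<omega> x * (kernel_K p w l u (n + 1) n x v * \<phi> v)" for v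
    by (simp add: kernel_Lambda_def algebra_simps)
  show "integrable M (\<lambda>s. kernel_Lambda p w l u \<omega> n x (Z s) * \<phi> (Z s))"
    unfolding eq by (intro Bochner_Integration.integrable_add integrable_mult_right K)
  have "(\<integral>s. kernel_Lambda p w l u \<omega> n x (Z s) * \<phi> (Z s) \<partial>M)
      = deriv \<omega> x * (\<integral>s. kernel_K p w l u n n x (Z s) * \<phi> (Z s) \<partial>M)
        + \<omega> x * (\<integral>s. kernel_K p w l u (n + 1) n x (Z s) * \<phi> (Z s) \<partial>M)"
    unfolding eq using K(1) by (subst Bochner_Integration.integral_add) auto
  then show "(\<integral>s. kernel_Lambda p w l u \<omega> n x (Z s) * \<phi> (Z s) \<partial>M)
      = (-1) ^ n * A * (LBINT t:einterval l (ereal x). \<phi> t * L n t) - B * (LBINT t:einterval (ereal x) u. \<phi> t * U n t)"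
    unfolding K(2) by (simp add: algebra_simps)
qed

text \<open>For \<open>\<phi> = 1\<close> the integrals of the tails of order \<open>n\<close> are
  the tails of order \<open>n + 1\<close>, and the result is the left side of
  \<open>A_B_balance\<close>.\<close>

lemma kernel_Lambda_total:
  shows "integrable M (\<lambda>s. kernel_Lambda p w l u \<omega> n x (Z s))"
    and "(\<integral>s. kernel_Lambda p w l u \<omega> n x (Z s) \<partial>M) = - (\<omega> x / w x)"
  using kernel_Lambda_expectation[of "\<lambda>_. 1"] lo.set_integrable_lP[of n x] set_integrable_U[of n x]
    lo.lP_Suc[of n x] U_Suc[of n x] lo.supp_bounds[OF x] A_B_balance by simp_all

lemmas H_n_measurable = H_measurable[OF order_refl]
lemmas H_n_L_U_integrable = H_L_U_integrable_supp[OF x]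

lemma \<omega>_deriv_f:
  "((\<lambda>y. \<omega> y * (deriv ^^ n) f y) has_real_derivative (-1) ^ n * A * I n x - B * J n x + \<omega> x / w x * H n x) (at x)"
proof -
  have "((\<lambda>y. \<omega> y * (deriv ^^ n) f y) has_real_derivative
     deriv \<omega> x * F n x + ((-1) ^ n * a (Suc n) x * I n x - b (Suc n) x * J n x + H n x / w x) * \<omega> x) (at x)"
    using DERIV_mult[OF \<omega>_deriv deriv_f_deriv[OF order_refl x]] deriv_f_eq_F[OF order_refl x] by simp
  moreover have "deriv \<omega> x * F n x + ((-1) ^ n * a (Suc n) x * I n x - b (Suc n) x * J n x + H n x / w x) * \<omega> x
     = (-1) ^ n * A * I n x - B * J n x + \<omega> x / w x * H n x"
    by (simp add: F_def algebra_simps)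
  ultimately show ?thesis by simp
qed

lemma \<omega>_deriv_f_Lambda:
  shows "integrable M (\<lambda>s. kernel_Lambda p w l u \<omega> n x (Z s) * H n (Z s))"
    and "((\<lambda>y. \<omega> y * (deriv ^^ n) f y) has_real_derivative
      \<omega> x / w x * H n x + (\<integral>s. kernel_Lambda p w l u \<omega> n x (Z s) * H n (Z s) \<partial>M)) (at x)"
  using kernel_Lambda_expectation[OF H_n_measurable H_n_L_U_integrable] \<omega>_deriv_f by (simp_all add: add.commute)

lemma deriv_\<omega>_f: "deriv (\<lambda>y. \<omega> y * (deriv ^^ n) f y) x = (-1) ^ n * A * I n x - B * J n x + \<omega> x / w x * H n x"
  by (rule DERIV_imp_deriv[OF \<omega>_deriv_f])

lemma I_J_bounds:
  assumes "\<And>t. t \<in> supp p \<Longrightarrow> c \<le> H n t \<and> H n t \<le> C"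
  shows "c * L (n + 1) x \<le> I n x" "I n x \<le> C * L (n + 1) x" "c * U (n + 1) x \<le> J n x" "J n x \<le> C * U (n + 1) x"
  using lo.LBINT_lP_bounds[OF H_n_L_U_integrable(1) lo.supp_bounds(2)[OF x] assms]
    LBINT_U_bounds[OF H_n_L_U_integrable(2) lo.supp_bounds(1)[OF x] assms] by simp_all

lemma fun_V_nonneg: "0 \<le> fun_V p w l u \<omega> n x"
  unfolding fun_V_eq using lo.lP_nonneg U_nonneg by (intro add_nonneg_nonneg mult_nonneg_nonneg) auto

lemma abs_deriv_\<omega>_f_le:
  assumes \<omega>_pos: "0 < \<omega> x" and bound: "\<And>t. t \<in> supp p \<Longrightarrow> \<bar>H n t\<bar> \<le> N"
  shows "\<bar>deriv (\<lambda>y. \<omega> y * (deriv ^^ n) f y) x\<bar> \<le> (\<omega> x / w x + fun_V p w l u \<omega> n x) * N"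
proof -
  have b: "- N \<le> H n t \<and> H n t \<le> N" if "t \<in> supp p" for t using bound[OF that] by (simp add: abs_le_iff)
  have "\<bar>I n x\<bar> \<le> N * L (n + 1) x" "\<bar>J n x\<bar> \<le> N * U (n + 1) x"
    using I_J_bounds[OF b] by (simp_all add: abs_le_iff)
  then have "\<bar>(-1) ^ n * A * I n x\<bar> \<le> \<bar>A\<bar> * (N * L (n + 1) x)" "\<bar>B * J n x\<bar> \<le> \<bar>B\<bar> * (N * U (n + 1) x)"
    by (simp_all add: abs_mult power_abs mult_left_mono)
  moreover have "\<bar>\<omega> x / w x * H n x\<bar> \<le> \<omega> x / w x * N"
  proof -
    have r: "0 \<le> \<omega> x / w x" using \<omega>_pos w_pos[OF x] by simp
    show ?thesis using mult_left_mono[OF bound[OF x] r] by (simp only: abs_mult abs_of_nonneg[OF r])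
  qed
  ultimately have "\<bar>deriv (\<lambda>y. \<omega> y * (deriv ^^ n) f y) x\<bar>
      \<le> \<bar>A\<bar> * (N * L (n + 1) x) + \<bar>B\<bar> * (N * U (n + 1) x) + \<omega> x / w x * N"
    unfolding deriv_\<omega>_f by linarith
  then show ?thesis unfolding fun_V_eq by (simp add: algebra_simps)
qed

context
  assumes \<omega>_pos: "0 < \<omega> x"
    and sign: "(-1) ^ n * deriv (\<lambda>y. \<omega> y * a n y) x \<le> 0" "0 \<le> deriv (\<lambda>y. \<omega> y * b n y) x"
begin

lemma sign': "(-1) ^ n * A \<le> 0" "0 \<le> B"
  using sign unfolding deriv_\<omega>_a deriv_\<omega>_b .

text \<open>The sign conditions resolve the absolute values in precisely the way that makes the sum
  the negative of \<open>A_B_balance\<close>.\<close>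

lemma fun_V_eq_ratio: "fun_V p w l u \<omega> n x = \<omega> x / w x"
proof -
  have "\<bar>A\<bar> = \<bar>(-1) ^ n * A\<bar>" by (simp add: abs_mult power_abs)
  also have "\<dots> = - ((-1) ^ n * A)" using sign'(1) by (rule abs_of_nonpos)
  finally show ?thesis unfolding fun_V_eq using sign'(2) A_B_balance by simp
qed

text \<open>Replacing \<open>H n\<close> by a constant \<open>k\<close> makes the three terms of the
  derivative cancel, by \<open>A_B_balance\<close> times \<open>k\<close>. The signs make the two
  integral terms decreasing in \<open>H n\<close> and the local term increasing, so inserting
  \<open>c\<close> in the former and \<open>C\<close> in the latter bounds the sum above by
  \<open>\<omega> x / w x * (C - c)\<close>; exchanging \<open>c\<close> and \<open>C\<close> bounds
  it below.\<close>

lemma abs_deriv_\<omega>_f_le_osc: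
  assumes bound: "\<And>t. t \<in> supp p \<Longrightarrow> c \<le> H n t \<and> H n t \<le> C"
  shows "\<bar>deriv (\<lambda>y. \<omega> y * (deriv ^^ n) f y) x\<bar> \<le> \<omega> x / w x * (C - c)"
proof -
  note b = I_J_bounds[OF bound]
  let ?A = "(-1) ^ n * A"
  have balance: "\<omega> x / w x * k = - (?A * (k * L (n + 1) x)) + B * (k * U (n + 1) x)" for k
  proof -
    have "\<omega> x / w x * k = - (?A * L (n + 1) x - B * U (n + 1) x) * k" unfolding A_B_balance by simp
    then show ?thesis by (simp add: algebra_simps)
  qed
  have "?A * (C * L (n + 1) x) \<le> ?A * I n x" "?A * I n x \<le> ?A * (c * L (n + 1) x)"
    using b sign'(1) by (auto intro!: mult_left_mono_neg)
  moreover have "B * (c * U (n + 1) x) \<le> B * J n x" "B * J n x \<le> B * (C * U (n + 1) x)"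
    using b sign'(2) by (auto intro!: mult_left_mono)
  moreover have "\<omega> x / w x * c \<le> \<omega> x / w x * H n x" "\<omega> x / w x * H n x \<le> \<omega> x / w x * C"
    using bound[OF x] \<omega>_pos w_pos[OF x] by (auto intro!: mult_left_mono simp del: times_divide_eq_left)
  ultimately show ?thesis
    unfolding deriv_\<omega>_f using balance[of c] balance[of C] by (simp add: abs_le_iff right_diff_distrib)
qed

end

end

end

section \<open>Essential norm, oscillation and measurability of derivatives\<close>

lemma AE_lebesgue_on_iff:
  "open S \<Longrightarrow> (AE x in lebesgue_on S. P x) \<longleftrightarrow> (AE x in lborel. x \<in> S \<longrightarrow> P x)" for S :: "real set"
  by (subst AE_restrict_space_iff) (auto simp: AE_completion_iff)

text \<open>The limit of difference quotients along \<open>1 / (i + 1)\<close>, taken for the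
  extension of \<open>g\<close> by zero, is Borel and equals the derivative almost everywhere on
  \<open>S\<close>; completeness of Lebesgue measure does the rest. This is needed to bound an
  essential supremum from above.\<close>

lemma deriv_measurable_lebesgue_on:
  fixes g :: "real \<Rightarrow> real"
  assumes S: "open S" and cont: "continuous_on S g"
    and diff: "AE x in lborel. x \<in> S \<longrightarrow> g field_differentiable at x"
  shows "deriv g \<in> borel_measurable (lebesgue_on S)"
proof -
  define k where "k x = indicator S x *\<^sub>R g x" for x
  have [measurable]: "S \<in> sets borel" using S by simp
  have [measurable]: "k \<in> borel_measurable borel"
    unfolding k_def[abs_def] using cont by (intro borel_measurable_continuous_on_indicator) auto
  define q where "q x = lim (\<lambda>i. (k (x + inverse (real (Suc i))) - k x) / inverse (real (Suc i)))" for x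
  have [measurable]: "q \<in> borel_measurable borel"
    unfolding q_def[abs_def] by (intro borel_measurable_lim_metric) measurable
  have q: "q x = deriv g x" if x: "x \<in> S" and "g field_differentiable at x" for x
  proof -
    have "(g has_real_derivative deriv g x) (at x)"
      using that by (simp add: DERIV_deriv_iff_field_differentiable)
    then have "(k has_real_derivative deriv g x) (at x)"
      by (rule has_field_derivative_transform_within_open[OF _ S x]) (simp add: k_def)
    then have "((\<lambda>d. (k (x + d) - k x) / d) \<longlongrightarrow> deriv g x) (at 0)" by (simp add: DERIV_def)
    moreover have "filterlim (\<lambda>i. inverse (real (Suc i))) (at 0) sequentially"
      by (intro filterlim_atI LIMSEQ_inverse_real_of_nat) (simp del: of_nat_Suc)
    ultimately have "(\<lambda>i. (k (x + inverse (real (Suc i))) - k x) / inverse (real (Suc i))) \<longlonglongrightarrow> deriv g x"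
      by (rule filterlim_compose)
    then show ?thesis unfolding q_def by (rule limI)
  qed
  have "(\<lambda>x. indicator S x *\<^sub>R deriv g x) \<in> borel_measurable lebesgue"
  proof (rule borel_measurable_AE)
    show "(\<lambda>x. indicator S x *\<^sub>R q x) \<in> borel_measurable lebesgue"
      by (intro measurable_completion) measurable
    show "AE x in lebesgue. indicator S x *\<^sub>R q x = indicator S x *\<^sub>R deriv g x"
      unfolding AE_completion_iff using diff by (rule AE_mp) (auto simp: q indicator_def)
  qed
  then show ?thesis using S by (subst borel_measurable_restrict_space_iff) auto
qed

text \<open>If the value at \<open>x\<close> exceeded the norm, then by continuity so would the
  values on an interval to the right of \<open>x\<close>, which is not null. The almost everywhere
  bound thereby becomes pointwise, as the integral estimates use it.\<close>

lemma abs_le_ess_norm_on: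
  assumes S: "open S" and cont: "continuous_on S g" and x: "x \<in> S"
  shows "ereal \<bar>g x\<bar> \<le> ess_norm_on S g"
proof (rule ccontr)
  let ?N = "ess_norm_on S g"
  assume "\<not> ereal \<bar>g x\<bar> \<le> ?N"
  then have less: "?N < ereal \<bar>g x\<bar>" by simp
  have "isCont g x" using S cont x by (simp add: continuous_on_eq_continuous_at)
  then have "((\<lambda>y. ereal \<bar>g y\<bar>) \<longlongrightarrow> ereal \<bar>g x\<bar>) (at x)"
    by (intro tendsto_intros) (simp add: isCont_def)
  then have "eventually (\<lambda>y. ?N < ereal \<bar>g y\<bar>) (at x)" using less by (rule order_tendstoD)
  moreover have "eventually (\<lambda>y. y \<in> S) (at x)" using S x by (rule eventually_at_in_open')
  ultimately have "eventually (\<lambda>y. ?N < ereal \<bar>g y\<bar> \<and> y \<in> S) (at x)" by eventually_elim simp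
  then obtain d where d: "0 < d" "\<And>y. y \<noteq> x \<Longrightarrow> dist y x < d \<Longrightarrow> ?N < ereal \<bar>g y\<bar> \<and> y \<in> S"
    unfolding eventually_at by auto
  have "AE y in lborel. y \<in> S \<longrightarrow> ereal \<bar>g y\<bar> \<le> ?N"
    unfolding AE_lebesgue_on_iff[OF S, symmetric] ess_norm_on_def by (rule esssup_AE)
  then have "AE y in lborel. y \<notin> {x<..<x + d}"
  proof (rule AE_mp, intro AE_I2 impI notI)
    fix y assume "y \<in> S \<longrightarrow> ereal \<bar>g y\<bar> \<le> ?N" "y \<in> {x<..<x + d}"
    then show False using d(2)[of y] by (auto simp: dist_real_def)
  qed
  then show False using d(1) not_AE_not_in_Ioo[of x "x + d"] by simp
qed

text \<open>Produces the two instances of the tail locale. The points of the interval outside the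
  support form a finite, hence null, set, and reflection maps support points below \<open>x\<close>
  to support points above \<open>- x\<close>.\<close>

lemma lower_tail_reflect_finite:
  fixes p :: "real \<Rightarrow> real"
  assumes p[measurable]: "p \<in> borel_measurable borel" and nonneg: "\<And>x. 0 \<le> p x"
    and "open (supp p)" "\<And>x. x \<in> supp p \<Longrightarrow> isCont p x" "supp p \<subseteq> einterval l u"
    and upper: "\<And>x. ereal x < u \<Longrightarrow> \<exists>y\<in>supp p. x < y"
    and lower: "\<And>x. l < ereal x \<Longrightarrow> \<exists>y\<in>supp p. y < x"
    and fin: "finite (einterval l u - supp p)"
    and "\<And>x. x \<in> supp p \<Longrightarrow> lower_P p l (n + 1) x < \<infinity>"
    and fin_upper: "\<And>x. x \<in> supp p \<Longrightarrow> upper_P p u (n + 1) x < \<infinity>"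
  shows "lower_tail p l u n" "lower_tail (\<lambda>t. p (- t)) (- u) (- l) n"
proof -
  have AE: "AE x in lborel. x \<in> S \<longrightarrow> x \<in> T" if "finite (S - T)" for S T :: "real set"
    using AE_not_in[OF finite_imp_null_set_lborel[OF that]] by (rule AE_mp) auto
  show "lower_tail p l u n"
    using assms AE[OF fin] by unfold_locales auto
  have supp': "supp (\<lambda>t. p (- t)) = uminus ` supp p"
    by (force simp: supp_def image_iff intro: exI[of _ "- _"])
  show "lower_tail (\<lambda>t. p (- t)) (- u) (- l) n"
  proof
    show "(\<lambda>t. p (- t)) \<in> borel_measurable borel" by measurable
    show "0 \<le> p (- x)" for x by (rule nonneg)
    show "open (supp (\<lambda>t. p (- t)))" unfolding supp' using assms(3) by (rule open_negations)
    show "isCont (\<lambda>t. p (- t)) x" if "x \<in> supp (\<lambda>t. p (- t))" for x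
      using that assms(4)[of "- x"] by (intro isCont_o2[of x uminus p]) (auto simp: supp_def)
    show "supp (\<lambda>t. p (- t)) \<subseteq> einterval (- u) (- l)"
    proof
      fix x assume "x \<in> supp (\<lambda>t. p (- t))"
      then have "- x \<in> einterval l u" using assms(5) by (auto simp: supp_def)
      then show "x \<in> einterval (- u) (- l)"
        using ereal_uminus_less_reorder[of u "ereal x"] ereal_less_uminus_reorder[of "ereal x" l]
        by (simp add: einterval_iff)
    qed
    show "\<exists>y\<in>supp (\<lambda>t. p (- t)). x < y" if "ereal x < - l" for x
    proof -
      have "l < ereal (- x)" using that ereal_less_uminus_reorder[of "ereal x" l] by simp
      then obtain y where "y \<in> supp p" "y < - x" using lower by blast
      then show ?thesis by (intro bexI[of _ "- y"]) (auto simp: supp_def)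
    qed
    show "AE x in lborel. x \<in> einterval (- u) (- l) \<longrightarrow> x \<in> supp (\<lambda>t. p (- t))"
    proof (rule AE, rule finite_subset[OF _ finite_imageI[OF fin, of uminus]], rule subsetI)
      fix x assume "x \<in> einterval (- u) (- l) - supp (\<lambda>t. p (- t))"
      then have "- x \<in> einterval l u - supp p"
        using ereal_uminus_less_reorder[of u "ereal x"] ereal_less_uminus_reorder[of "ereal x" l]
        by (simp add: einterval_iff supp_def)
      then show "x \<in> uminus ` (einterval l u - supp p)" by force
    qed
    show "lower_P (\<lambda>t. p (- t)) (- u) (n + 1) x < \<infinity>" if "x \<in> supp (\<lambda>t. p (- t))" for x
      using fin_upper[of "- x"] that upper_P_reflect[OF p, of u "n + 1" "- x"] by (simp add: supp_def)
  qed
qed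

lemma osc_on_le_2_ess_norm_on:
  assumes "open S" "continuous_on S g" "S \<noteq> {}"
  shows "osc_on S g \<le> 2 * ess_norm_on S g"
proof -
  let ?N = "ess_norm_on S g"
  have b: "ereal \<bar>g x\<bar> \<le> ?N" if "x \<in> S" for x using abs_le_ess_norm_on assms that by blast
  have "(SUP x\<in>S. ereal (g x)) \<le> ?N"
    by (rule SUP_least) (metis b abs_ge_self ereal_less_eq(3) order_trans)
  moreover have "- ?N \<le> (INF x\<in>S. ereal (g x))"
  proof (rule INF_greatest)
    fix x assume "x \<in> S"
    have "- ?N \<le> - ereal \<bar>g x\<bar>" using b[OF \<open>x \<in> S\<close>] by (simp only: ereal_minus_le_minus)
    also have "\<dots> \<le> ereal (g x)" by simp
    finally show "- ?N \<le> ereal (g x)" .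
  qed
  ultimately have "osc_on S g \<le> ?N - (- ?N)" unfolding osc_on_def by (rule ereal_minus_mono)
  also have "\<dots> = 2 * ?N" by (cases ?N) auto
  finally show ?thesis .
qed

text \<open>A value of \<open>g\<close> lies between the infimum and the supremum, so the supremum
  is not minus infinity and the infimum is not plus infinity. Hence either both are real or the
  oscillation is infinite.\<close>

lemma osc_on_cases:
  assumes "S \<noteq> {}"
  obtains "osc_on S g = \<infinity>"
    | c C where "osc_on S g = ereal (C - c)" "\<And>x. x \<in> S \<Longrightarrow> c \<le> g x \<and> g x \<le> C"
proof -
  obtain x where x: "x \<in> S" using assms by blast
  let ?C = "SUP x\<in>S. ereal (g x)" and ?c = "INF x\<in>S. ereal (g x)"
  have C: "ereal (g y) \<le> ?C" and c: "?c \<le> ereal (g y)" if "y \<in> S" for y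
    using that by (auto intro: SUP_upper INF_lower)
  show thesis
  proof (cases ?C; cases ?c)
    fix C' c' assume *: "?C = ereal C'" "?c = ereal c'"
    show thesis
    proof (rule that(2))
      show "osc_on S g = ereal (C' - c')" unfolding osc_on_def * by simp
      show "c' \<le> g y \<and> g y \<le> C'" if "y \<in> S" for y using C[OF that] c[OF that] unfolding * by simp
    qed
  qed (use that(1) C[OF x] c[OF x] in \<open>auto simp: osc_on_def\<close>)
qed

section \<open>The estimates in extended reals\<close>

context stein_setting
begin

context
  fixes \<omega> :: "real \<Rightarrow> real"
  assumes \<omega>_pos: "\<And>x. x \<in> supp p \<Longrightarrow> 0 < \<omega> x" and \<omega>_ac: "locally_abs_cont_on (supp p) \<omega>"
begin

lemma AE_\<omega>: "AE x in lborel. x \<in> supp p \<longrightarrow> \<omega> field_differentiable at x"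
  by (rule locally_abs_cont_on_AE_differentiable[OF lo.open_supp \<omega>_ac])

lemma abs_H_le_ess_norm_on: "x \<in> supp p \<Longrightarrow> ereal \<bar>H n x\<bar> \<le> ess_norm_on (supp p) (H n)"
  by (rule abs_le_ess_norm_on[OF lo.open_supp continuous_on_subset[OF H_cont[OF order_refl]]]) auto

lemma abs_deriv_\<omega>_f_le_ess_norm:
  assumes x: "x \<in> supp p" "\<omega> field_differentiable at x"
  shows "ereal \<bar>deriv (\<lambda>y. \<omega> y * (deriv ^^ n) f y) x\<bar>
     \<le> ereal (\<omega> x / w x + fun_V p w l u \<omega> n x) * ess_norm_on (supp p) (H n)"
proof (cases "ess_norm_on (supp p) (H n)")
  case (real N)
  have "\<bar>H n t\<bar> \<le> N" if "t \<in> supp p" for t using abs_H_le_ess_norm_on[OF that] real by simp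
  then show ?thesis using abs_deriv_\<omega>_f_le[OF x \<omega>_pos[OF x(1)]] real by simp
next
  case PInf
  \<comment> \<open>Strict positivity matters here: zero times infinity is zero in
    \<open>ereal\<close>, and the bound would then not be trivial.\<close>
  have "0 < \<omega> x / w x + fun_V p w l u \<omega> n x"
    using \<omega>_pos[OF x(1)] w_pos[OF x(1)] fun_V_nonneg[OF x] by (simp add: add_pos_nonneg)
  then show ?thesis using PInf by simp
next
  case MInf
  then show ?thesis using abs_H_le_ess_norm_on[OF x(1)] by simp
qed

lemma abs_deriv_\<omega>_f_le_osc_on:
  assumes x: "x \<in> supp p" "\<omega> field_differentiable at x"
    and sign: "(-1) ^ n * deriv (\<lambda>y. \<omega> y * a n y) x \<le> 0" "0 \<le> deriv (\<lambda>y. \<omega> y * b n y) x"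
  shows "ereal \<bar>deriv (\<lambda>y. \<omega> y * (deriv ^^ n) f y) x\<bar> \<le> ereal (\<omega> x / w x) * osc_on (supp p) (H n)"
proof -
  have "supp p \<noteq> {}" using x by blast
  then show ?thesis
  proof (cases rule: osc_on_cases[where g = "H n"])
    case 1
    then show ?thesis using \<omega>_pos[OF x(1)] w_pos[OF x(1)] by simp
  next
    case (2 c C)
    then show ?thesis using abs_deriv_\<omega>_f_le_osc[OF x \<omega>_pos[OF x(1)] sign, of c C] by simp
  qed
qed

lemma deriv_\<omega>_f_measurable:
  "deriv (\<lambda>y. \<omega> y * (deriv ^^ n) f y) \<in> borel_measurable (lebesgue_on (supp p))"
proof (rule deriv_measurable_lebesgue_on[OF lo.open_supp])
  have "isCont \<omega> x" if "x \<in> supp p" for x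
    using locally_abs_cont_on_imp_isCont[OF \<omega>_ac lo.open_supp that] .
  moreover have "isCont ((deriv ^^ n) f) x" if "x \<in> supp p" for x
    using deriv_f_deriv[OF order_refl that] by (rule DERIV_isCont)
  ultimately show "continuous_on (supp p) (\<lambda>y. \<omega> y * (deriv ^^ n) f y)"
    by (intro continuous_on_mult continuous_at_imp_continuous_on) auto
  show "AE x in lborel. x \<in> supp p \<longrightarrow> (\<lambda>y. \<omega> y * (deriv ^^ n) f y) field_differentiable at x"
    using AE_\<omega> by (rule AE_mp) (auto simp: field_differentiable_def[of "\<lambda>y. \<omega> y * (deriv ^^ n) f y"] intro: \<omega>_deriv_f)
qed

lemma ess_norm_on_deriv_\<omega>_f_le:
  assumes sign: "AE x in lborel. x \<in> supp p \<longrightarrow> (-1) ^ n * deriv (\<lambda>y. \<omega> y * a n y) x \<le> 0 \<and>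
        deriv (\<lambda>y. \<omega> y * b n y) x \<ge> 0"
  shows "ess_norm_on (supp p) (deriv (\<lambda>y. \<omega> y * (deriv ^^ n) f y))
       \<le> 2 * ess_norm_on (supp p) (\<lambda>x. \<omega> x / w x) * ess_norm_on (supp p) (H n)"
    (is "_ \<le> 2 * ?W * ?N")
  unfolding ess_norm_on_def[of _ "deriv (\<lambda>y. \<omega> y * (deriv ^^ n) f y)"]
proof (rule esssup_I)
  show "(\<lambda>x. ereal \<bar>deriv (\<lambda>y. \<omega> y * (deriv ^^ n) f y) x\<bar>) \<in> borel_measurable (lebesgue_on (supp p))"
    using deriv_\<omega>_f_measurable by measurable
  have ne: "supp p \<noteq> {}" using supp_nonempty by blast
  \<comment> \<open>Nonnegativity of the norm is what allows \<open>ereal (\<omega> x / w x)\<close>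
    to be replaced by the larger \<open>?W\<close> in a product of extended reals.\<close>
  then have N: "0 \<le> ?N" using abs_H_le_ess_norm_on by (metis abs_ge_zero all_not_in_conv ereal_less_eq(5) order_trans)
  have osc: "osc_on (supp p) (H n) \<le> 2 * ?N"
    by (rule osc_on_le_2_ess_norm_on[OF lo.open_supp continuous_on_subset[OF H_cont[OF order_refl]] ne]) simp
  have W: "AE x in lborel. x \<in> supp p \<longrightarrow> ereal \<bar>\<omega> x / w x\<bar> \<le> ?W"
    unfolding AE_lebesgue_on_iff[OF lo.open_supp, symmetric] ess_norm_on_def by (rule esssup_AE)
  show "AE x in lebesgue_on (supp p). ereal \<bar>deriv (\<lambda>y. \<omega> y * (deriv ^^ n) f y) x\<bar> \<le> 2 * ?W * ?N"
    unfolding AE_lebesgue_on_iff[OF lo.open_supp]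
    using AE_\<omega> sign W
  proof (eventually_elim, intro impI)
    fix x assume x: "x \<in> supp p" and "x \<in> supp p \<longrightarrow> \<omega> field_differentiable at x"
      and "x \<in> supp p \<longrightarrow> (-1) ^ n * deriv (\<lambda>y. \<omega> y * a n y) x \<le> 0 \<and> deriv (\<lambda>y. \<omega> y * b n y) x \<ge> 0"
      and W: "x \<in> supp p \<longrightarrow> ereal \<bar>\<omega> x / w x\<bar> \<le> ?W"
    then have "ereal \<bar>deriv (\<lambda>y. \<omega> y * (deriv ^^ n) f y) x\<bar> \<le> ereal (\<omega> x / w x) * osc_on (supp p) (H n)"
      by (intro abs_deriv_\<omega>_f_le_osc_on) auto
    also have "\<dots> \<le> ereal (\<omega> x / w x) * (2 * ?N)"
      using \<omega>_pos[OF x] w_pos[OF x] by (intro ereal_mult_left_mono osc) simp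
    also have "\<dots> \<le> ?W * (2 * ?N)"
      using W x \<omega>_pos[OF x] w_pos[OF x] N by (intro ereal_mult_right_mono) auto
    also have "\<dots> = 2 * ?W * ?N" by (simp add: mult_ac)
    finally show "ereal \<bar>deriv (\<lambda>y. \<omega> y * (deriv ^^ n) f y) x\<bar> \<le> 2 * ?W * ?N" .
  qed
qed

end

end

section \<open>Geometry of the partition\<close>

context
  fixes e :: "nat \<Rightarrow> ereal" and m :: nat
  assumes m: "m \<ge> 1" and e: "\<And>r. r < m \<Longrightarrow> e r < e (r + 1)"
begin

lemma partition_mono: "r \<le> s \<Longrightarrow> s \<le> m \<Longrightarrow> e r \<le> e s"
proof (induction rule: dec_induct)
  case (step s)
  then show ?case using e[of s] by (auto intro: order_trans less_imp_le)
qed simp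

lemma partition_subset: "(\<Union>r\<in>{1..m}. einterval (e (r - 1)) (e r)) \<subseteq> einterval (e 0) (e m)"
proof
  fix x assume "x \<in> (\<Union>r\<in>{1..m}. einterval (e (r - 1)) (e r))"
  then obtain r where r: "r \<in> {1..m}" "e (r - 1) < ereal x" "ereal x < e r" by (auto simp: einterval_iff)
  moreover have "e 0 \<le> e (r - 1)" "e r \<le> e m"
    using r(1) by (auto intro!: partition_mono)
  ultimately show "x \<in> einterval (e 0) (e m)"
    by (auto simp: einterval_iff intro: le_less_trans less_le_trans)
qed

text \<open>Only break points are missed: going down from \<open>e k\<close>, a point above
  \<open>e 0\<close> lies either in the last piece, or at its left end, or below it, where the
  induction applies.\<close>

lemma partition_finite: "finite (einterval (e 0) (e m) - (\<Union>r\<in>{1..m}. einterval (e (r - 1)) (e r)))"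
proof -
  \<comment> \<open>Infinite end points are sent to zero by \<open>real_of_ereal\<close>; this
    merely enlarges the finite set that contains the exceptions.\<close>
  have cover: "ereal x < e k \<Longrightarrow> k \<le> m \<Longrightarrow> e 0 < ereal x \<Longrightarrow>
      x \<in> real_of_ereal ` e ` {..m} \<or> x \<in> (\<Union>r\<in>{1..m}. einterval (e (r - 1)) (e r))" for x k
  proof (induction k)
    case (Suc k)
    consider "ereal x < e k" | "ereal x = e k" | "e k < ereal x" by fastforce
    then show ?case
    proof cases
      case 2
      then have "x = real_of_ereal (e k)" by (metis real_of_ereal.simps(1))
      then show ?thesis using Suc.prems by auto
    next
      case 3
      then have "x \<in> einterval (e (Suc k - 1)) (e (Suc k))" using Suc.prems by (simp add: einterval_iff)
      then show ?thesis using Suc.prems by (intro disjI2 UN_I[of "Suc k"]) auto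
    qed (use Suc in auto)
  qed (auto dest: less_asym)
  show ?thesis
  proof (rule finite_subset[of _ "real_of_ereal ` e ` {..m}"], rule subsetI)
    fix x assume "x \<in> einterval (e 0) (e m) - (\<Union>r\<in>{1..m}. einterval (e (r - 1)) (e r))"
    then show "x \<in> real_of_ereal ` e ` {..m}"
      using cover[of x m] unfolding einterval_iff Diff_iff by blast
  qed simp
qed

lemma partition_upper:
  assumes "ereal x < e m"
  shows "\<exists>y\<in>(\<Union>r\<in>{1..m}. einterval (e (r - 1)) (e r)). x < y"
proof -
  have "max (ereal x) (e (m - 1)) < e m" using assms e[of "m - 1"] m by auto
  then obtain y where "max (ereal x) (e (m - 1)) < ereal y" "ereal y < e m" using ereal_dense2 by blast
  then show ?thesis using m by (intro bexI[of _ y] UN_I[of m]) (auto simp: einterval_iff)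
qed

lemma partition_lower:
  assumes "e 0 < ereal x"
  shows "\<exists>y\<in>(\<Union>r\<in>{1..m}. einterval (e (r - 1)) (e r)). y < x"
proof -
  have "e 0 < min (ereal x) (e 1)" using assms e[of 0] m by auto
  then obtain y where "e 0 < ereal y" "ereal y < min (ereal x) (e 1)" using ereal_dense2 by blast
  then show ?thesis using m by (intro bexI[of _ y] UN_I[of 1]) (auto simp: einterval_iff)
qed

end

section \<open>Assembly from the tail instances and the pointwise estimates\<close>

theorem proposition2p35:
  fixes M :: "'a measure" and Z :: "'a \<Rightarrow> real"
    and p w h \<omega> :: "real \<Rightarrow> real"
    and m n :: nat and e :: "nat \<Rightarrow> ereal" and l u :: ereal
  assumes "prob_space M"
    and "\<And>x. 0 \<le> p x"
    and "distributed M lborel Z (\<lambda>x. ennreal (p x))"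
    and "m \<ge> 1" and "l = e 0" and "u = e m"
    and "\<And>r. r < m \<Longrightarrow> e r < e (r + 1)"
    and "supp p = (\<Union>r\<in>{1..m}. einterval (e (r - 1)) (e r))"
    and "\<And>r. r \<in> {1..m} \<Longrightarrow> locally_abs_cont_on (einterval (e (r - 1)) (e r)) p"
    and "\<And>x. x \<in> supp p \<Longrightarrow> 0 < w x"
    and "\<And>r. r \<in> {1..m} \<Longrightarrow>
           locally_abs_cont_on (einterval (e (r - 1)) (e r)) (\<lambda>x. w x * p x)"
    and "integrable (density lborel (\<lambda>x. ennreal (p x))) h"
    and "\<And>r x. r \<ge> 1 \<Longrightarrow> fun_M_defined p w l u r (int r - 1) \<Longrightarrow> x \<in> supp p \<Longrightarrow>
           fun_M p w l u r (int r - 1) x = - 1 / w x"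
    and "\<And>r x. fun_M_defined p w l u r (int r) \<Longrightarrow> x \<in> supp p \<Longrightarrow>
           fun_M p w l u r (int r) x = 0"
    and "\<And>x. x \<in> supp p \<Longrightarrow> 0 < \<omega> x"
    and "locally_abs_cont_on (supp p) \<omega>"
    and "times_differentiable_on n UNIV h"
    and "kernel_hyp M Z p w l u n n ((deriv ^^ n) h)"
    and "kernel_hyp M Z p w l u (n + 1) n ((deriv ^^ n) h)"
  shows "times_differentiable_on n (supp p) (stein_f M Z p w l h) \<and>
    (AE x in lborel. x \<in> supp p \<longrightarrow>
       integrable M (\<lambda>s. kernel_Lambda p w l u \<omega> n x (Z s) * (deriv ^^ n) h (Z s)) \<and>
       ((\<lambda>y. \<omega> y * (deriv ^^ n) (stein_f M Z p w l h) y) has_real_derivative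
          \<omega> x / w x * (deriv ^^ n) h x
          + (\<integral>s. kernel_Lambda p w l u \<omega> n x (Z s) * (deriv ^^ n) h (Z s) \<partial>M)) (at x)) \<and>
    (AE x in lborel. x \<in> supp p \<longrightarrow>
       integrable M (\<lambda>s. kernel_Lambda p w l u \<omega> n x (Z s)) \<and>
       (\<integral>s. kernel_Lambda p w l u \<omega> n x (Z s) \<partial>M) = - (\<omega> x / w x)) \<and>
    (AE x in lborel. x \<in> supp p \<longrightarrow>
       ereal \<bar>deriv (\<lambda>y. \<omega> y * (deriv ^^ n) (stein_f M Z p w l h) y) x\<bar>
         \<le> ereal (\<omega> x / w x + fun_V p w l u \<omega> n x) * ess_norm_on (supp p) ((deriv ^^ n) h)) \<and>
    ((AE x in lborel. x \<in> supp p \<longrightarrow>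
        (-1) ^ n * deriv (\<lambda>y. \<omega> y * (deriv ^^ n) (upper_m p w u) y) x \<le> 0 \<and>
        deriv (\<lambda>y. \<omega> y * (deriv ^^ n) (lower_m p w l) y) x \<ge> 0) \<longrightarrow>
     (AE x in lborel. x \<in> supp p \<longrightarrow> fun_V p w l u \<omega> n x = \<omega> x / w x) \<and>
     (AE x in lborel. x \<in> supp p \<longrightarrow>
        ereal \<bar>deriv (\<lambda>y. \<omega> y * (deriv ^^ n) (stein_f M Z p w l h) y) x\<bar>
          \<le> ereal (\<omega> x / w x) * osc_on (supp p) ((deriv ^^ n) h)) \<and>
     ess_norm_on (supp p) (deriv (\<lambda>y. \<omega> y * (deriv ^^ n) (stein_f M Z p w l h) y))
       \<le> 2 * ess_norm_on (supp p) (\<lambda>x. \<omega> x / w x) * ess_norm_on (supp p) ((deriv ^^ n) h))"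
proof -
  note partition = partition_subset[of m e, OF assms(4) assms(7)] partition_upper[of m e, OF assms(4) assms(7)]
    partition_lower[of m e, OF assms(4) assms(7)] partition_finite[of m e, OF assms(4) assms(7)]
  note partition = partition[folded assms(8), folded assms(5,6)]
  have p: "p \<in> borel_measurable borel"
    using distributed_real_measurable[OF assms(2) assms(3)] by simp
  have cont: "isCont p x" if x: "x \<in> supp p" for x
  proof -
    obtain r where "r \<in> {1..m}" "x \<in> einterval (e (r - 1)) (e r)" using x unfolding assms(8) by blast
    then show ?thesis using assms(9) locally_abs_cont_on_imp_isCont open_einterval by blast
  qed
  have op: "open (supp p)" unfolding assms(8) by (intro open_UN ballI open_einterval)
  have fin: "lower_P p l (n + 1) x < \<infinity>" "upper_P p u (n + 1) x < \<infinity>" if "x \<in> supp p" for x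
    using assms(18) that unfolding kernel_hyp_def by blast+
  \<comment> \<open>Here the partition is traded for the two tail instances, whose finiteness
    conditions come from part (a) of the kernel hypotheses.\<close>
  note tails = lower_tail_reflect_finite[of p l u n, OF p assms(2) op cont partition fin]
  interpret stein_setting M Z p w h l u n
    by (intro stein_setting.intro stein_setting_axioms.intro assms tails)
  have AE: "AE x in lborel. x \<in> supp p \<longrightarrow> \<omega> field_differentiable at x"
    by (rule AE_\<omega>; fact assms)
  have 1: "AE x in lborel. x \<in> supp p \<longrightarrow>
       integrable M (\<lambda>s. kernel_Lambda p w l u \<omega> n x (Z s) * H n (Z s)) \<and>
       ((\<lambda>y. \<omega> y * (deriv ^^ n) f y) has_real_derivative \<omega> x / w x * H n x
          + (\<integral>s. kernel_Lambda p w l u \<omega> n x (Z s) * H n (Z s) \<partial>M)) (at x)"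
    using AE by eventually_elim (intro impI conjI \<omega>_deriv_f_Lambda; simp)
  have 2: "AE x in lborel. x \<in> supp p \<longrightarrow>
       integrable M (\<lambda>s. kernel_Lambda p w l u \<omega> n x (Z s)) \<and>
       (\<integral>s. kernel_Lambda p w l u \<omega> n x (Z s) \<partial>M) = - (\<omega> x / w x)"
    using AE by eventually_elim (intro impI conjI kernel_Lambda_total; simp)
  have 3: "AE x in lborel. x \<in> supp p \<longrightarrow> ereal \<bar>deriv (\<lambda>y. \<omega> y * (deriv ^^ n) f y) x\<bar>
         \<le> ereal (\<omega> x / w x + fun_V p w l u \<omega> n x) * ess_norm_on (supp p) (H n)"
    using AE by eventually_elim (intro impI abs_deriv_\<omega>_f_le_ess_norm assms(15,16); simp)
  show ?thesis
  proof (intro conjI impI times_differentiable_f 1 2 3)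
    assume sign: "AE x in lborel. x \<in> supp p \<longrightarrow> (-1) ^ n * deriv (\<lambda>y. \<omega> y * a n y) x \<le> 0 \<and>
        deriv (\<lambda>y. \<omega> y * b n y) x \<ge> 0"
    show "AE x in lborel. x \<in> supp p \<longrightarrow> fun_V p w l u \<omega> n x = \<omega> x / w x"
      using AE sign by eventually_elim (intro impI fun_V_eq_ratio assms(15); simp)
    show "AE x in lborel. x \<in> supp p \<longrightarrow> ereal \<bar>deriv (\<lambda>y. \<omega> y * (deriv ^^ n) f y) x\<bar>
          \<le> ereal (\<omega> x / w x) * osc_on (supp p) (H n)"
      using AE sign by eventually_elim (intro impI abs_deriv_\<omega>_f_le_osc_on assms(15,16); simp)
    show "ess_norm_on (supp p) (deriv (\<lambda>y. \<omega> y * (deriv ^^ n) f y))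
       \<le> 2 * ess_norm_on (supp p) (\<lambda>x. \<omega> x / w x) * ess_norm_on (supp p) (H n)"
      using sign by (intro ess_norm_on_deriv_\<omega>_f_le assms(15,16))
  qed
qed

end
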